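(* Let $H_0\in C^2(\mathbb{R}^d)$ be convex, coercive ($H_0(p)\to+\infty$ as $|p|\to\infty$) and superlinear ($H_0(p)/|p|\to+\infty$ as $|p|\to\infty$), let $V:\mathbb{T}^d\to\mathbb{R}$ be Lipschitz continuous and semiconcave, let $g:\mathbb{T}^d\to\mathbb{R}$ be Lipschitz continuous and semiconcave, and set $H(x,p)=H_0(p)-V(x)$. Let $u$ be the viscosity solution of $$-\partial_tu+H(x,Du)=0\ \text{ in }\mathbb{T}^d\times(0,T),\qquad u(\cdot,T)=g\ \text{ on }\mathbb{T}^d .$$ For $\varepsilon=(h,\Delta t)$ with $h=1/I$, $I\ge1$ an integer, $\Delta t>0$ and $N=T/\Delta t$ a positive integer, let $\tilde u_n^\varepsilon=\mathcal{I}[u_n^\varepsilon]$, $n=0,\dots,N$, be the piecewise-multilinear interpolants of the solution $u^\varepsilon_n:\mathcal{G}\to\mathbb{R}$ of the fully discrete semi-Lagrangian scheme $$u^\varepsilon_n(x_i)=\inf_{\alpha\in\mathbb{R}^d}\big\{\mathcal{I}[u^\varepsilon_{n+1}](x_i-\Delta t\,\alpha)+\Delta t\,(L(\alpha)+V(x_i))\big\},\quad x_i\in\mathcal{G},\ n=0,\dots,N-1,\qquad u^\varepsilon_N(x_i)=g(x_i),\ x_i\in\mathcal{G},$$ where $L$ is the Legendre transform of $H_0$. Then there exists a constant $C>0$, independent of $\varepsilon$, such that for all such $\varepsilon$ $$\sup_{n=0,\dots,N}\big\|\tilde u_n^\varepsilon(\cdot)-u(\cdot,n\Delta t)\big\|_{L^1(\mathbb{T}^d)}\le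 C\Big(\Delta t+\frac{h}{\Delta t}\Big).$$ Moreover, for any $p\in[1,+\infty]$ there exists a constant $C>0$, independent of $\varepsilon$, such that for all such $\varepsilon$ $$\sup_{n=0,\dots,N}\|\tilde u_n^\varepsilon(\cdot)-u(\cdot,n\Delta t)\|_{L^p(\mathbb{T}^d)}\le C\Big(\Delta t+\frac{h}{\Delta t}\Big)^{\frac1p}\Big(\Delta t^{\frac12}+\frac{h}{\Delta t}\Big)^{1-\frac1p},$$ with the convention $1/p=0$ for $p=+\infty$.
   Context: Fix $d\ge1$ and $T>0$. $\mathbb{T}^d=\mathbb{R}^d/\mathbb{Z}^d$ is the flat torus; functions on $\mathbb{T}^d$ are identified with $\mathbb{Z}^d$-periodic functions on $\mathbb{R}^d$. A function $u$ is semiconcave if there is $C_{conc}>0$ such that for all $x_1,x_2$ and $\lambda\in(0,1)$: $u(\lambda x_1+(1-\lambda)x_2)\ge\lambda u(x_1)+(1-\lambda)u(x_2)-\lambda(1-\lambda)C_{conc}|x_1-x_2|^2$. The Legendre transform is $L(\alpha)=\sup_{p\in\mathbb{R}^d}\{\alpha\cdot p-H_0(p)\}$. The viscosity solution of the backward problem is the function $u$ such that $v(x,s)=u(x,T-s)$ is the viscosity solution of $\partial_sv+H(x,Dv)=0$, $v(\cdot,0)=g$; equivalently it is the value function $u(x,t)=\inf_{\alpha\in L^2([t,T];\mathbb{R}^d)}\big\{\int_t^T[L(\alpha(s))+V(X(s))]\,ds+g(X(T))\big\}$ where $\dot X(s)=-\alpha(s)$ on $(t,T)$, $X(t)=x$.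 Grid: $\mathcal{G}=\{x_i=hi:\ i\in\{0,\dots,I-1\}^d\}\subset\mathbb{T}^d$, with indices understood modulo $I$. Piecewise-multilinear interpolation of a grid function $v:\mathcal{G}\to\mathbb{R}$: for $x$ in the cell $Q_i=x_i+[0,h)^d$, $\mathcal{I}[v](x)=\sum_{\sigma\in\{0,1\}^d}\lambda_\sigma(x)v(x_{i+\sigma})$, with $\lambda_\sigma(x)=\prod_{j=1}^d\theta_j^{\sigma_j}(1-\theta_j)^{1-\sigma_j}$, $\theta=(x-x_i)/h\in[0,1)^d$. *)

theory Defs
  imports "HOL-Analysis.Analysis" "HOL-Probability.Essential_Supremum"
begin

text \<open>
  The space \<open>\<real>^d\<close> is \<^typ>\<open>real ^ 'n\<close> with \<open>d = CARD('n)\<close>, and a function on the flat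
  torus is a \<open>\<int>^d\<close>-periodic function on \<^typ>\<open>real ^ 'n\<close>.
\<close>

definition torus_fun :: "(real ^ 'n \<Rightarrow> 'a) \<Rightarrow> bool" where
  "torus_fun f \<longleftrightarrow> (\<forall>x k. (\<forall>j. k $ j \<in> \<int>) \<longrightarrow> f (x + k) = f x)"

definition semiconcave :: "(real ^ 'n \<Rightarrow> real) \<Rightarrow> bool" where
  "semiconcave f \<longleftrightarrow>
     (\<exists>C>0. \<forall>x y. \<forall>\<mu>\<in>{0<..<1}.
        f (\<mu> *\<^sub>R x + (1 - \<mu>) *\<^sub>R y)
          \<ge> \<mu> * f x + (1 - \<mu>) * f y - \<mu> * (1 - \<mu>) * C * (norm (x - y))\<^sup>2)"

definition C1_on :: "'a::real_inner set \<Rightarrow> ('a \<Rightarrow> real) \<Rightarrow> ('a \<Rightarrow> 'a) \<Rightarrow> bool" where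
  "C1_on S f Df \<longleftrightarrow> (\<forall>x\<in>S. GDERIV f x :> Df x) \<and> continuous_on S Df"

definition C2 :: "('a::real_inner \<Rightarrow> real) \<Rightarrow> bool" where
  "C2 f \<longleftrightarrow>
     (\<exists>Df (D2f :: 'a \<Rightarrow> 'a \<Rightarrow>\<^sub>L 'a).
        (\<forall>x. GDERIV f x :> Df x) \<and>
        (\<forall>x. (Df has_derivative blinfun_apply (D2f x)) (at x)) \<and>
        continuous_on UNIV D2f)"

text \<open>The supremum is over the reals, hence meaningful because of superlinearity of \<open>H\<^sub>0\<close>.\<close>

definition legendre :: "(real ^ 'n \<Rightarrow> real) \<Rightarrow> real ^ 'n \<Rightarrow> real" where
  "legendre H\<^sub>0 \<alpha> = (SUP p. \<alpha> \<bullet> p - H\<^sub>0 p)"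

text \<open>
  Viscosity solutions of \<open>\<partial>\<^sub>s v + H(x, Dv) = 0\<close> on the torus times \<open>(0, T)\<close>. Functions of
  \<open>(x, s)\<close> are functions on pairs, and the gradient of a test function \<open>\<phi>\<close> is the pair
  \<open>(D\<phi>, \<partial>\<^sub>s\<phi>)\<close>. Since only the local behaviour at the contact point matters, test functions
  are not required to be periodic.
\<close>

definition viscosity_subsolution ::
    "real \<Rightarrow> (real ^ 'n \<Rightarrow> real ^ 'n \<Rightarrow> real) \<Rightarrow> ((real ^ 'n) \<times> real \<Rightarrow> real) \<Rightarrow> bool" where
  "viscosity_subsolution T H v \<longleftrightarrow>
     (\<forall>\<phi> D\<phi> x s.
        C1_on (UNIV \<times> {0<..<T}) \<phi> D\<phi> \<and> s \<in> {0<..<T} \<and>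
        (\<forall>\<^sub>F z in nhds (x, s). v z - \<phi> z \<le> v (x, s) - \<phi> (x, s)) \<longrightarrow>
        snd (D\<phi> (x, s)) + H x (fst (D\<phi> (x, s))) \<le> 0)"

definition viscosity_supersolution ::
    "real \<Rightarrow> (real ^ 'n \<Rightarrow> real ^ 'n \<Rightarrow> real) \<Rightarrow> ((real ^ 'n) \<times> real \<Rightarrow> real) \<Rightarrow> bool" where
  "viscosity_supersolution T H v \<longleftrightarrow>
     (\<forall>\<phi> D\<phi> x s.
        C1_on (UNIV \<times> {0<..<T}) \<phi> D\<phi> \<and> s \<in> {0<..<T} \<and>
        (\<forall>\<^sub>F z in nhds (x, s). v z - \<phi> z \<ge> v (x, s) - \<phi> (x, s)) \<longrightarrow>
        snd (D\<phi> (x, s)) + H x (fst (D\<phi> (x, s))) \<ge> 0)"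

definition viscosity_solution ::
    "real \<Rightarrow> (real ^ 'n \<Rightarrow> real ^ 'n \<Rightarrow> real) \<Rightarrow> (real ^ 'n \<Rightarrow> real) \<Rightarrow> ((real ^ 'n) \<times> real \<Rightarrow> real) \<Rightarrow> bool"
  where
  "viscosity_solution T H g v \<longleftrightarrow>
     (\<forall>s\<in>{0..T}. torus_fun (\<lambda>x. v (x, s))) \<and>
     continuous_on (UNIV \<times> {0..T}) v \<and>
     viscosity_subsolution T H v \<and> viscosity_supersolution T H v \<and>
     (\<forall>x. v (x, 0) = g x)"

definition backward_viscosity_solution ::
    "real \<Rightarrow> (real ^ 'n \<Rightarrow> real ^ 'n \<Rightarrow> real) \<Rightarrow> (real ^ 'n \<Rightarrow> real) \<Rightarrow> ((real ^ 'n) \<times> real \<Rightarrow> real) \<Rightarrow> bool"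
  where
  "backward_viscosity_solution T H g u \<longleftrightarrow> viscosity_solution T H g (\<lambda>(x, s). u (x, T - s))"

text \<open>
  A grid function is a function on multi-indices \<^typ>\<open>int ^ 'n\<close> of which only the values on
  \<^term>\<open>{i :: int ^ 'n. \<forall>j. i $ j \<in> {0..<int m}}\<close> are used (\<open>m\<close> points per direction,
  mesh size \<open>h = 1 / m\<close>).
\<close>

definition grid_indices :: "nat \<Rightarrow> (int ^ 'n) set" where
  "grid_indices m = {i. \<forall>j. i $ j \<in> {0..<int m}}"

definition grid_point :: "nat \<Rightarrow> int ^ 'n \<Rightarrow> real ^ 'n" where
  "grid_point m i = (1 / real m) *\<^sub>R (\<chi> j. real_of_int (i $ j))"

text \<open>
  The cell containing \<open>x\<close> has index \<open>i\<close> with \<open>i\<^sub>j = \<lfloor>x\<^sub>j / h\<rfloor>\<close>; the indices \<open>i + \<sigma>\<close> of its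
  vertices are reduced modulo \<open>m\<close>.
\<close>

definition multilinear_interp :: "nat \<Rightarrow> (int ^ 'n \<Rightarrow> real) \<Rightarrow> real ^ 'n \<Rightarrow> real" where
  "multilinear_interp m v x =
     (let h = 1 / real m;
          i = (\<chi> j. \<lfloor>x $ j / h\<rfloor>) :: int ^ 'n;
          \<theta> = (1 / h) *\<^sub>R (x - grid_point m i)
      in \<Sum>\<sigma> | \<forall>j. (\<sigma> :: nat ^ 'n) $ j \<in> {0, 1}.
           (\<Prod>j\<in>UNIV. (\<theta> $ j) ^ (\<sigma> $ j) * (1 - \<theta> $ j) ^ (1 - \<sigma> $ j)) *
           v (\<chi> j. (i $ j + int (\<sigma> $ j)) mod int m))"

definition semi_lagrangian ::
    "(real ^ 'n \<Rightarrow> real) \<Rightarrow> (real ^ 'n \<Rightarrow> real) \<Rightarrow> (real ^ 'n \<Rightarrow> real) \<Rightarrow>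
     nat \<Rightarrow> real \<Rightarrow> nat \<Rightarrow> (nat \<Rightarrow> int ^ 'n \<Rightarrow> real) \<Rightarrow> bool" where
  "semi_lagrangian L V g m dt N U \<longleftrightarrow>
     (\<forall>n<N. \<forall>i\<in>grid_indices m.
        U n i = (INF \<alpha>. multilinear_interp m (U (Suc n)) (grid_point m i - dt *\<^sub>R \<alpha>)
                         + dt * (L \<alpha> + V (grid_point m i)))) \<and>
     (\<forall>i\<in>grid_indices m. U N i = g (grid_point m i))"

text \<open>
  The \<open>L\<^sup>p\<close> norm on the torus, as an extended nonnegative number, computed on the
  fundamental domain \<open>[0,1]^d\<close>.
\<close>

definition torus_norm :: "ennreal \<Rightarrow> (real ^ 'n \<Rightarrow> real) \<Rightarrow> ennreal" where
  "torus_norm p f =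
     (let M = restrict_space lborel (cbox 0 1) in
      if p = \<infinity> then esssup M (\<lambda>x. ennreal \<bar>f x\<bar>)
      else let J = \<integral>\<^sup>+ x. ennreal (\<bar>f x\<bar> powr enn2real p) \<partial>M in
           if J = \<infinity> then \<infinity> else ennreal (enn2real J powr (1 / enn2real p)))"

end

theory Submission
  imports Defs
begin

text \<open>
  The error is of order \<open>dt + h / dt\<close> uniformly in \<open>x\<close>, and this carries all the estimates. The
  torus has measure one, so the same quantity bounds every \<open>L\<^sup>p\<close> norm. Moreover
  \<open>dt \<le> sqrt T * sqrt dt\<close>, so the rate \<open>a = dt + h / dt\<close> is at most a constant times
  \<open>b = sqrt dt + h / dt\<close>, and \<open>a = a\<^sup>q * a\<^sup>1\<^sup>-\<^sup>q\<close> is at most a constant times \<open>a\<^sup>q * b\<^sup>1\<^sup>-\<^sup>q\<close>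
  with \<open>q = 1 / p\<close>.

  The grid function \<open>U n\<close> and the viscosity solution are both compared with a function that is
  discrete in time only. It is obtained by splitting: one step applies the Hopf-Lax operator of
  \<open>H\<^sub>0\<close> for the time \<open>dt\<close> and then adds \<open>dt * V\<close>. Each step increases the Lipschitz constant by at
  most \<open>dt\<close> times that of \<open>V\<close>, so a single constant \<open>\<Lambda>\<close> serves for all steps and all step sizes.
  Superlinearity of \<open>H\<^sub>0\<close> then makes only the controls in some fixed ball of radius \<open>R\<close> relevant.

  Discretisation in space: interpolation is an average over the vertices of a cell, hence
  nonexpansive, and it changes a \<open>\<Lambda>\<close>-Lipschitz function by \<open>O(h)\<close>. Over \<open>T / dt\<close> steps this
  amounts to \<open>O(h / dt)\<close> (\<open>scheme_close_to_semi_discrete\<close>).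

  Discretisation in time: one step contributes \<open>O(dt\<^sup>2)\<close>, so the total is \<open>O(dt)\<close>. Here the
  separated form \<open>H\<^sub>0 p - V x\<close> matters. With time running forward and \<open>L\<close> the Legendre transform
  of \<open>H\<^sub>0\<close>, each inequality in the viscosity sense is first turned into a statement about straight
  lines.

  \<^item> A subsolution grows along a line of velocity \<open>\<alpha>\<close> at rate at most \<open>L \<alpha> + V\<close>
    (\<open>subsolution_along_line\<close>), as the inequality \<open>\<alpha> \<bullet> p - H\<^sub>0 p \<le> L \<alpha>\<close> suggests. Hence it is at
    most one splitting step plus \<open>O(dt\<^sup>2)\<close>, the velocities being bounded and \<open>V\<close> Lipschitz.

  \<^item> A supersolution lies above every Lipschitz function \<open>Z\<close> that lies below it initially and grows
    at rate at most \<open>L \<alpha> + V\<close> along the lines of velocity \<open>\<alpha> = DH\<^sub>0 p\<close>, for which \<open>L \<alpha>\<close> equals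
    \<open>\<alpha> \<bullet> p - H\<^sub>0 p\<close> (\<open>supersolution_ge_line_subsolution\<close>). By convexity of \<open>L\<close>, concatenating two
    lines never beats the single line between the same end points, so the Hopf-Lax evolution plus
    \<open>\<tau> * V - C * \<tau>\<^sup>2\<close> is such a function, and at \<open>\<tau> = dt\<close> it is one splitting step minus \<open>O(dt\<^sup>2)\<close>.
\<close>

section \<open>The Legendre transform of a superlinear Hamiltonian\<close>

lemma superlinear_lower_bound:
  fixes H :: "real ^ 'n \<Rightarrow> real"
  assumes cont: "continuous_on UNIV H"
    and sl: "filterlim (\<lambda>p. H p / norm p) at_top at_infinity"
  shows "\<exists>M. \<forall>p. R * norm p - M \<le> H p"
proof -
  obtain b where b: "\<And>p. b \<le> norm p \<Longrightarrow> R \<le> H p / norm p"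
    using sl unfolding filterlim_at_top eventually_at_infinity by meson
  define c where "c = max b 1"
  have "compact ((\<lambda>p. R * norm p - H p) ` cball 0 c)"
    by (intro compact_continuous_image continuous_intros continuous_on_subset[OF cont]) auto
  then have "bdd_above ((\<lambda>p. R * norm p - H p) ` cball 0 c)"
    by (intro bounded_imp_bdd_above compact_imp_bounded)
  then obtain M where "\<forall>p\<in>cball 0 c. R * norm p - H p \<le> M"
    unfolding bdd_above_def by blast
  then have M: "\<And>p. norm p \<le> c \<Longrightarrow> R * norm p - H p \<le> M" by simp
  have "R * norm p - max M 0 \<le> H p" for p
  proof (cases "norm p \<le> c")
    case True
    then show ?thesis using M[of p] by linarith
  next
    case False
    then have "norm p > 0" "b \<le> norm p" unfolding c_def by auto
    then have "R * norm p \<le> H p" using b[of p] by (simp add: field_simps)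
    then show ?thesis by linarith
  qed
  then show ?thesis by blast
qed

lemma legendre_bdd_above:
  fixes H :: "real ^ 'n \<Rightarrow> real"
  assumes "\<And>p. norm \<alpha> * norm p - M \<le> H p"
  shows "bdd_above (range (\<lambda>p. \<alpha> \<bullet> p - H p))" and "legendre H \<alpha> \<le> M"
proof -
  have *: "\<alpha> \<bullet> p - H p \<le> M" for p
    using assms[of p] norm_cauchy_schwarz[of \<alpha> p] by linarith
  then show "bdd_above (range (\<lambda>p. \<alpha> \<bullet> p - H p))" by (intro bdd_aboveI) auto
  show "legendre H \<alpha> \<le> M"
    unfolding legendre_def using * by (intro cSUP_least) auto
qed

lemma legendre_lower:
  fixes H :: "real ^ 'n \<Rightarrow> real"
  assumes cont: "continuous_on UNIV H"
    and sl: "filterlim (\<lambda>p. H p / norm p) at_top at_infinity"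
  shows "\<alpha> \<bullet> p - H p \<le> legendre H \<alpha>"
proof -
  obtain M where "\<And>p. norm \<alpha> * norm p - M \<le> H p"
    using superlinear_lower_bound[OF cont sl] by blast
  from legendre_bdd_above(1)[OF this] show ?thesis
    unfolding legendre_def by (intro cSUP_upper) auto
qed

lemma legendre_bounded_on_balls:
  fixes H :: "real ^ 'n \<Rightarrow> real"
  assumes cont: "continuous_on UNIV H"
    and sl: "filterlim (\<lambda>p. H p / norm p) at_top at_infinity"
  shows "\<exists>B. \<forall>\<alpha>. norm \<alpha> \<le> R \<longrightarrow> \<bar>legendre H \<alpha>\<bar> \<le> B"
proof -
  obtain M where M: "\<And>p. R * norm p - M \<le> H p"
    using superlinear_lower_bound[OF cont sl] by blast
  have "\<bar>legendre H \<alpha>\<bar> \<le> max M (H 0)" if "norm \<alpha> \<le> R" for \<alpha>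
  proof -
    have "norm \<alpha> * norm p - M \<le> H p" for p
      using M[of p] mult_right_mono[OF that, of "norm p"] by auto
    from legendre_bdd_above(2)[OF this] legendre_lower[OF cont sl, of \<alpha> 0] show ?thesis by auto
  qed
  then show ?thesis by blast
qed

lemma convex_legendre:
  fixes H :: "real ^ 'n \<Rightarrow> real"
  assumes cont: "continuous_on UNIV H"
    and sl: "filterlim (\<lambda>p. H p / norm p) at_top at_infinity"
  shows "convex_on UNIV (legendre H)"
proof (rule convex_onI)
  fix t :: real and x y :: "real ^ 'n"
  assume t: "0 < t" "t < 1"
  have "((1 - t) *\<^sub>R x + t *\<^sub>R y) \<bullet> p - H p \<le> (1 - t) * legendre H x + t * legendre H y" for p
  proof -
    have "(1 - t) * (x \<bullet> p - H p) + t * (y \<bullet> p - H p) \<le> (1 - t) * legendre H x + t * legendre H y"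
      using t legendre_lower[OF cont sl] by (intro add_mono mult_left_mono) auto
    then show ?thesis by (simp add: inner_add_left algebra_simps)
  qed
  then show "legendre H ((1 - t) *\<^sub>R x + t *\<^sub>R y) \<le> (1 - t) * legendre H x + t * legendre H y"
    unfolding legendre_def[of H "(1 - t) *\<^sub>R x + t *\<^sub>R y"] by (intro cSUP_least) auto
qed auto

text \<open>
  Testing the supremum with the vector \<open>p\<close> of length \<open>\<Lambda> + 1\<close> in the direction of \<open>\<alpha>\<close> gives a
  lower bound of slope \<open>\<Lambda> + 1\<close>; the surplus slope absorbs the constant. Controls this expensive
  cannot compete with the zero control against a \<open>\<Lambda>\<close>-Lipschitz function.
\<close>

lemma legendre_coercive:
  fixes H :: "real ^ 'n \<Rightarrow> real"
  assumes cont: "continuous_on UNIV H"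
    and sl: "filterlim (\<lambda>p. H p / norm p) at_top at_infinity"
    and "\<Lambda> \<ge> 0"
  shows "\<exists>R\<ge>0. \<forall>\<alpha>. norm \<alpha> \<ge> R \<longrightarrow> legendre H 0 + \<Lambda> * norm \<alpha> \<le> legendre H \<alpha>"
proof -
  have "compact (H ` cball 0 (\<Lambda> + 1))"
    by (intro compact_continuous_image continuous_on_subset[OF cont]) auto
  then have "bdd_above (H ` cball 0 (\<Lambda> + 1))"
    by (intro bounded_imp_bdd_above compact_imp_bounded)
  then obtain M where "\<forall>p\<in>cball 0 (\<Lambda> + 1). H p \<le> M"
    unfolding bdd_above_def by blast
  then have M: "\<And>p. norm p \<le> \<Lambda> + 1 \<Longrightarrow> H p \<le> M" by simp
  have "legendre H 0 + \<Lambda> * norm \<alpha> \<le> legendre H \<alpha>" if "norm \<alpha> \<ge> max 1 (M + legendre H 0)" for \<alpha>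
  proof -
    define p where "p = ((\<Lambda> + 1) / norm \<alpha>) *\<^sub>R \<alpha>"
    have "norm \<alpha> > 0" using that by auto
    then have "norm p = \<Lambda> + 1" "\<alpha> \<bullet> p = (\<Lambda> + 1) * norm \<alpha>"
      using assms(3) by (auto simp: p_def power2_norm_eq_inner[symmetric] power2_eq_square)
    then have "(\<Lambda> + 1) * norm \<alpha> - M \<le> legendre H \<alpha>"
      using M[of p] legendre_lower[OF cont sl, of \<alpha> p] by auto
    then show ?thesis using that by (auto simp: algebra_simps)
  qed
  then show ?thesis by (intro exI[of _ "max 1 (M + legendre H 0)"]) auto
qed

text \<open>
  A convex function lies above its tangent at \<open>p\<close>, so the supremum defining the transform at the
  slope of that tangent is attained at \<open>p\<close>. In this way the Hamiltonian at \<open>p\<close> is recovered from the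
  cost of the single velocity \<open>DH p\<close>.
\<close>

lemma legendre_at_gradient:
  fixes H :: "real ^ 'n \<Rightarrow> real"
  assumes sl: "filterlim (\<lambda>p. H p / norm p) at_top at_infinity"
    and cvx: "convex_on UNIV H" and grad: "\<And>p. GDERIV H p :> DH p"
  shows "legendre H (DH p) = DH p \<bullet> p - H p"
proof -
  have cont: "continuous_on UNIV H"
    using grad unfolding gderiv_def
    by (intro continuous_at_imp_continuous_on ballI has_derivative_continuous) blast
  have tangent: "H p + DH p \<bullet> (q - p) \<le> H q" for q
  proof -
    define f where "f t = H (p + t *\<^sub>R (q - p))" for t
    have der: "(f has_real_derivative DH p \<bullet> (q - p)) (at 0)"
    proof -
      have "(H has_derivative (\<lambda>h. h \<bullet> DH p)) (at (p + 0 *\<^sub>R (q - p)))"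
        using grad[of p] by (simp add: gderiv_def)
      then have "(f has_derivative (\<lambda>t. (t *\<^sub>R (q - p)) \<bullet> DH p)) (at 0)"
        unfolding f_def
        by (intro has_derivative_compose[of "\<lambda>t. p + t *\<^sub>R (q - p)" "\<lambda>t. t *\<^sub>R (q - p)" 0 UNIV H])
           (auto intro!: derivative_eq_intros)
      moreover have "(\<lambda>t. (t *\<^sub>R (q - p)) \<bullet> DH p) = (*) (DH p \<bullet> (q - p))"
        by (auto simp: inner_commute mult.commute)
      ultimately show ?thesis by (simp add: has_field_derivative_def)
    qed
    have "convex_on UNIV f"
      unfolding f_def
    proof (rule convex_onI)
      fix t x y :: real assume t: "0 < t" "t < 1"
      have "p + ((1 - t) *\<^sub>R x + t *\<^sub>R y) *\<^sub>R (q - p)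
          = (1 - t) *\<^sub>R (p + x *\<^sub>R (q - p)) + t *\<^sub>R (p + y *\<^sub>R (q - p))"
        by (simp add: algebra_simps)
      then show "H (p + ((1 - t) *\<^sub>R x + t *\<^sub>R y) *\<^sub>R (q - p))
          \<le> (1 - t) * H (p + x *\<^sub>R (q - p)) + t * H (p + y *\<^sub>R (q - p))"
        using convex_onD[OF cvx, of t "p + x *\<^sub>R (q - p)" "p + y *\<^sub>R (q - p)"] t by simp
    qed auto
    then have "f 1 - f 0 \<ge> (DH p \<bullet> (q - p)) * (1 - 0)"
      by (intro convex_on_imp_above_tangent[where A = UNIV]) (use der in auto)
    then show ?thesis by (simp add: f_def)
  qed
  show ?thesis
  proof (rule antisym)
    show "legendre H (DH p) \<le> DH p \<bullet> p - H p"
      unfolding legendre_def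
      by (intro cSUP_least) (use tangent in \<open>auto simp: inner_diff_right algebra_simps\<close>)
    show "DH p \<bullet> p - H p \<le> legendre H (DH p)" by (rule legendre_lower[OF cont sl])
  qed
qed

section \<open>Multilinear interpolation\<close>

definition interp_weight :: "nat \<Rightarrow> real ^ 'n \<Rightarrow> nat ^ 'n \<Rightarrow> real" where
  "interp_weight m x \<sigma> =
     (\<Prod>j\<in>UNIV. frac (real m * x $ j) ^ (\<sigma> $ j) * (1 - frac (real m * x $ j)) ^ (1 - \<sigma> $ j))"

definition cell_vertex :: "nat \<Rightarrow> real ^ 'n \<Rightarrow> nat ^ 'n \<Rightarrow> int ^ 'n" where
  "cell_vertex m x \<sigma> = (\<chi> j. \<lfloor>real m * x $ j\<rfloor> + int (\<sigma> $ j))"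

definition reduce_index :: "nat \<Rightarrow> int ^ 'n \<Rightarrow> int ^ 'n" where
  "reduce_index m i = (\<chi> j. i $ j mod int m)"

text \<open>
  Fractional parts free the weights from any reference to the cell index; what remains visible is
  an average of vertex values, and nonexpansiveness and the error bound need only that.
\<close>

lemma multilinear_interp_eq:
  assumes "m \<ge> 1"
  shows "multilinear_interp m v x =
    (\<Sum>\<sigma> | \<forall>j. \<sigma> $ j \<in> {0, 1}. interp_weight m x \<sigma> * v (reduce_index m (cell_vertex m x \<sigma>)))"
proof -
  have "(1 / (1 / real m)) *\<^sub>R (x - grid_point m (\<chi> j. \<lfloor>x $ j / (1 / real m)\<rfloor>))
      = (\<chi> j. frac (real m * x $ j))"
    using assms by (auto simp: vec_eq_iff grid_point_def frac_def field_simps)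
  then show ?thesis
    unfolding multilinear_interp_def Let_def interp_weight_def cell_vertex_def reduce_index_def
    by (simp add: mult.commute)
qed

lemma interp_weight_nonneg: "interp_weight m x \<sigma> \<ge> 0"
  unfolding interp_weight_def
  by (intro prod_nonneg ballI mult_nonneg_nonneg zero_le_power)
     (auto simp: less_imp_le[OF frac_lt_1])

lemma interp_weight_sum: "(\<Sum>\<sigma> | \<forall>j. (\<sigma> :: nat ^ 'n) $ j \<in> {0, 1}. interp_weight m x \<sigma>) = 1"
proof -
  let ?C = "{\<sigma> :: nat ^ 'n. \<forall>j. \<sigma> $ j \<in> {0, 1}}"
  let ?P = "PiE (UNIV :: 'n set) (\<lambda>_. {0, 1 :: nat})"
  have bij: "bij_betw vec_lambda ?P ?C"
  proof (rule bij_betw_byWitness[where f' = vec_nth])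
    show "\<forall>s\<in>?P. vec_nth (vec_lambda s) = s" "\<forall>\<sigma>\<in>?C. vec_lambda (vec_nth \<sigma>) = \<sigma>"
      by (auto simp: fun_eq_iff)
    show "vec_lambda ` ?P \<subseteq> ?C"
    proof (intro image_subsetI CollectI allI)
      fix s j assume "s \<in> ?P"
      then have "s j \<in> {0, 1}" by (rule PiE_mem) simp
      then show "vec_lambda s $ j \<in> {0, 1}" by simp
    qed
    show "vec_nth ` ?C \<subseteq> ?P"
    proof (intro image_subsetI PiE_I)
      fix \<sigma> j assume "\<sigma> \<in> ?C"
      then show "\<sigma> $ j \<in> {0, 1}" by blast
    qed simp
  qed
  let ?\<theta> = "\<lambda>j. frac (real m * x $ j)"
  have "(\<Sum>\<sigma>\<in>?C. interp_weight m x \<sigma>)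
      = (\<Sum>s\<in>?P. \<Prod>j\<in>UNIV. ?\<theta> j ^ s j * (1 - ?\<theta> j) ^ (1 - s j))"
    unfolding interp_weight_def
    by (subst sum.reindex_bij_betw[OF bij, symmetric]) simp
  also have "\<dots> = (\<Prod>j\<in>UNIV. \<Sum>s\<in>{0, 1 :: nat}. ?\<theta> j ^ s * (1 - ?\<theta> j) ^ (1 - s))"
    by (subst prod_sum_PiE) auto
  also have "\<dots> = 1" by simp
  finally show "(\<Sum>\<sigma>\<in>?C. interp_weight m x \<sigma>) = 1" .
qed

lemma weighted_mean_close:
  fixes a :: "'a \<Rightarrow> real"
  assumes "\<And>s. s \<in> S \<Longrightarrow> c s \<ge> 0" "sum c S = 1" "\<And>s. s \<in> S \<Longrightarrow> \<bar>a s - b s\<bar> \<le> e"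
  shows "\<bar>(\<Sum>s\<in>S. c s * a s) - (\<Sum>s\<in>S. c s * b s)\<bar> \<le> e"
proof -
  have "\<bar>(\<Sum>s\<in>S. c s * a s) - (\<Sum>s\<in>S. c s * b s)\<bar> = \<bar>\<Sum>s\<in>S. c s * (a s - b s)\<bar>"
    by (simp add: sum_subtractf right_diff_distrib)
  also have "\<dots> \<le> (\<Sum>s\<in>S. c s * e)"
    using assms by (intro order_trans[OF sum_abs] sum_mono) (auto simp: abs_mult intro!: mult_left_mono)
  also have "\<dots> = e" using assms(2) by (simp add: sum_distrib_right[symmetric])
  finally show ?thesis .
qed

lemma reduce_index_grid: "m \<ge> 1 \<Longrightarrow> reduce_index m i \<in> grid_indices m"
  unfolding reduce_index_def grid_indices_def by simp

lemma multilinear_interp_nonexpansive: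
  fixes a b :: "int ^ 'n \<Rightarrow> real"
  assumes "m \<ge> 1" "\<And>i. i \<in> grid_indices m \<Longrightarrow> \<bar>a i - b i\<bar> \<le> e"
  shows "\<bar>multilinear_interp m a x - multilinear_interp m b x\<bar> \<le> e"
  unfolding multilinear_interp_eq[OF assms(1)]
  by (intro weighted_mean_close interp_weight_nonneg interp_weight_sum assms(2)
        reduce_index_grid[OF assms(1)])

lemma torus_fun_reduce_index:
  fixes w :: "real ^ 'n \<Rightarrow> real"
  assumes "m \<ge> 1" "torus_fun w"
  shows "w (grid_point m (reduce_index m i)) = w (grid_point m i)"
proof -
  define k :: "real ^ 'n" where "k = (\<chi> j. real_of_int (- (i $ j div int m)))"
  have "grid_point m (reduce_index m i) = grid_point m i + k"
  proof (subst vec_eq_iff, intro allI)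
    fix j
    have "i $ j mod int m = i $ j + int m * (- (i $ j div int m))"
      using minus_mult_div_eq_mod[of "i $ j" "int m"] by simp
    then have "real_of_int (i $ j mod int m)
        = real_of_int (i $ j) + real m * real_of_int (- (i $ j div int m))"
      by (simp only: of_int_add of_int_mult of_int_of_nat_eq)
    then show "grid_point m (reduce_index m i) $ j = (grid_point m i + k) $ j"
      using assms(1) by (simp add: grid_point_def reduce_index_def k_def add_divide_distrib diff_divide_distrib)
  qed
  moreover have "\<forall>j. k $ j \<in> \<int>" by (simp add: k_def)
  ultimately show ?thesis using assms(2) unfolding torus_fun_def by simp
qed

lemma multilinear_interp_error:
  fixes w :: "real ^ 'n \<Rightarrow> real"
  assumes m: "m \<ge> 1" and per: "torus_fun w"
    and lip: "\<And>x y. \<bar>w x - w y\<bar> \<le> \<Lambda> * norm (x - y)" and "\<Lambda> \<ge> 0"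
  shows "\<bar>multilinear_interp m (\<lambda>i. w (grid_point m i)) x - w x\<bar> \<le> \<Lambda> * real CARD('n) * (1 / real m)"
proof -
  let ?C = "{\<sigma> :: nat ^ 'n. \<forall>j. \<sigma> $ j \<in> {0, 1}}"
  have "\<bar>w (grid_point m (reduce_index m (cell_vertex m x \<sigma>))) - w x\<bar> \<le> \<Lambda> * real CARD('n) * (1 / real m)"
    if "\<sigma> \<in> ?C" for \<sigma>
  proof -
    let ?e = "grid_point m (cell_vertex m x \<sigma>) - x"
    have "\<bar>?e $ j\<bar> \<le> 1 / real m" for j
    proof -
      have "\<sigma> $ j \<in> {0, 1}" using that by auto
      then have "\<bar>real_of_int (\<lfloor>real m * x $ j\<rfloor> + int (\<sigma> $ j)) - real m * x $ j\<bar> \<le> 1"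
        by auto linarith+
      moreover have "?e $ j = (real_of_int (\<lfloor>real m * x $ j\<rfloor> + int (\<sigma> $ j)) - real m * x $ j) / real m"
        using m by (simp add: grid_point_def cell_vertex_def field_simps)
      ultimately show ?thesis using m by (simp add: divide_right_mono)
    qed
    then have "norm ?e \<le> real CARD('n) * (1 / real m)"
      using order_trans[OF norm_le_l1_cart sum_mono[of UNIV "\<lambda>j. \<bar>?e $ j\<bar>" "\<lambda>_. 1 / real m"]]
      by simp
    then show ?thesis
      using lip[of "grid_point m (cell_vertex m x \<sigma>)" x] mult_left_mono[OF _ \<open>\<Lambda> \<ge> 0\<close>]
      by (fastforce simp: torus_fun_reduce_index[OF m per] mult.assoc)
  qed
  then have "\<bar>(\<Sum>\<sigma>\<in>?C. interp_weight m x \<sigma> * w (grid_point m (reduce_index m (cell_vertex m x \<sigma>))))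
      - (\<Sum>\<sigma>\<in>?C. interp_weight m x \<sigma> * w x)\<bar> \<le> \<Lambda> * real CARD('n) * (1 / real m)"
    by (intro weighted_mean_close interp_weight_nonneg interp_weight_sum)
  then show ?thesis
    unfolding multilinear_interp_eq[OF m] sum_distrib_right[symmetric] interp_weight_sum by simp
qed

text \<open>
  The vertices of the cell of \<open>x\<close> take countably many values, each on a Borel set, so an arbitrary
  grid function composed with them is measurable. The essential supremum needs this, being
  \<open>\<infinity>\<close> by convention for a function that is not measurable.
\<close>

lemma borel_measurable_multilinear_interp:
  fixes v :: "int ^ 'n \<Rightarrow> real"
  assumes "m \<ge> 1"
  shows "multilinear_interp m v \<in> borel_measurable borel"
proof -
  have cv: "(\<lambda>x. cell_vertex m x \<sigma>) \<in> measurable borel (count_space UNIV)" for \<sigma> :: "nat ^ 'n"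
  proof (subst measurable_count_space_eq_countable)
    show "countable (UNIV :: (int ^ 'n) set)" by simp
    have "(\<lambda>x. cell_vertex m x \<sigma>) -` {i} \<inter> space borel \<in> sets borel" for i
    proof -
      have "(\<lambda>x. cell_vertex m x \<sigma>) -` {i} = {x. \<forall>j. \<lfloor>real m * x $ j\<rfloor> + int (\<sigma> $ j) = i $ j}"
        by (auto simp: cell_vertex_def vec_eq_iff)
      moreover have "{x \<in> space borel. \<forall>j\<in>UNIV. \<lfloor>real m * x $ j\<rfloor> + int (\<sigma> $ j) = i $ j} \<in> sets borel"
        by measurable
      ultimately show ?thesis by simp
    qed
    then show "(\<lambda>x. cell_vertex m x \<sigma>) \<in> space borel \<rightarrow> UNIV \<and>
        (\<forall>a\<in>UNIV. (\<lambda>x. cell_vertex m x \<sigma>) -` {a} \<inter> space borel \<in> sets borel)" by auto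
  qed
  have wt: "(\<lambda>x. interp_weight m x \<sigma>) \<in> borel_measurable borel" for \<sigma> :: "nat ^ 'n"
    unfolding interp_weight_def frac_def by measurable
  have "(\<lambda>x. v (reduce_index m (cell_vertex m x \<sigma>))) \<in> borel_measurable borel" for \<sigma>
    using measurable_compose[OF cv, of "\<lambda>i. v (reduce_index m i)"] by simp
  then have "(\<lambda>x. \<Sum>\<sigma> | \<forall>j. \<sigma> $ j \<in> {0, 1}.
      interp_weight m x \<sigma> * v (reduce_index m (cell_vertex m x \<sigma>))) \<in> borel_measurable borel"
    by (intro borel_measurable_sum borel_measurable_times wt)
  then show ?thesis unfolding multilinear_interp_eq[OF assms] .
qed

section \<open>Periodic functions on a strip\<close>

lemma integer_shift_into_unit_cube:
  fixes y :: "real ^ 'n"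
  obtains k where "\<forall>j. k $ j \<in> \<int>" "y + k \<in> cbox 0 1"
proof
  let ?k = "\<chi> j. - real_of_int \<lfloor>y $ j\<rfloor>"
  show "\<forall>j. ?k $ j \<in> \<int>" by simp
  have "0 \<le> y $ j - real_of_int \<lfloor>y $ j\<rfloor>" "y $ j - real_of_int \<lfloor>y $ j\<rfloor> \<le> 1" for j
    by linarith+
  then show "y + ?k \<in> cbox 0 1" by (simp add: mem_box_cart)
qed

lemma unit_cube_in_ball:
  obtains R where "\<And>x :: real ^ 'n. x \<in> cbox 0 1 \<Longrightarrow> norm x \<le> R"
  using bounded_cbox[of 0 "1 :: real ^ 'n"] unfolding bounded_iff by blast

lemma periodic_strip_bounded:
  fixes v :: "(real ^ 'n) \<times> real \<Rightarrow> real"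
  assumes cont: "continuous_on (UNIV \<times> {a..b}) v"
    and per: "\<And>s. s \<in> {a..b} \<Longrightarrow> torus_fun (\<lambda>x. v (x, s))"
  obtains B where "B \<ge> 0" "\<And>x s. s \<in> {a..b} \<Longrightarrow> \<bar>v (x, s)\<bar> \<le> B"
proof -
  have "compact (v ` (cbox 0 1 \<times> {a..b}))"
    by (intro compact_continuous_image compact_Times continuous_on_subset[OF cont]) auto
  then obtain B where B: "\<forall>z\<in>cbox 0 1 \<times> {a..b}. \<bar>v z\<bar> \<le> B"
    using compact_imp_bounded[of "v ` (cbox 0 1 \<times> {a..b})"] unfolding bounded_iff by auto
  show ?thesis
  proof
    fix x s assume s: "s \<in> {a..b}"
    obtain k :: "real ^ 'n" where k: "\<forall>j. k $ j \<in> \<int>" "x + k \<in> cbox 0 1"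
      by (rule integer_shift_into_unit_cube)
    have "v (x, s) = v (x + k, s)" using per[OF s] k(1) unfolding torus_fun_def by simp
    moreover have "\<bar>v (x + k, s)\<bar> \<le> B" using B k(2) s by blast
    ultimately show "\<bar>v (x, s)\<bar> \<le> max B 0" by simp
  qed simp
qed

lemma periodic_strip_uniformly_continuous:
  fixes v :: "(real ^ 'n) \<times> real \<Rightarrow> real"
  assumes cont: "continuous_on (UNIV \<times> {a..b}) v"
    and per: "\<And>s. s \<in> {a..b} \<Longrightarrow> torus_fun (\<lambda>x. v (x, s))" and "\<gamma> > 0"
  obtains \<delta> where "\<delta> > 0"
    "\<And>x s y r. s \<in> {a..b} \<Longrightarrow> r \<in> {a..b} \<Longrightarrow> norm ((x, s) - (y, r)) < \<delta> \<Longrightarrow> \<bar>v (x, s) - v (y, r)\<bar> < \<gamma>"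
proof -
  obtain R where R: "\<And>x :: real ^ 'n. x \<in> cbox 0 1 \<Longrightarrow> norm x \<le> R"
    using unit_cube_in_ball by blast
  let ?S = "cball (0 :: real ^ 'n) (R + 1) \<times> {a..b}"
  have "uniformly_continuous_on ?S v"
    by (intro compact_uniformly_continuous compact_Times continuous_on_subset[OF cont]) auto
  then obtain \<delta> where "\<delta> > 0"
    and \<delta>: "\<And>z z'. z \<in> ?S \<Longrightarrow> z' \<in> ?S \<Longrightarrow> dist z' z < \<delta> \<Longrightarrow> dist (v z') (v z) < \<gamma>"
    using \<open>\<gamma> > 0\<close> unfolding uniformly_continuous_on_def by metis
  show ?thesis
  proof
    show "min \<delta> 1 > 0" using \<open>\<delta> > 0\<close> by simp
    fix x y :: "real ^ 'n" and s r
    assume sr: "s \<in> {a..b}" "r \<in> {a..b}" and near: "norm ((x, s) - (y, r)) < min \<delta> 1"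
    obtain k :: "real ^ 'n" where k: "\<forall>j. k $ j \<in> \<int>" "y + k \<in> cbox 0 1"
      by (rule integer_shift_into_unit_cube)
    have eq: "v (x, s) = v (x + k, s)" "v (y, r) = v (y + k, r)"
      using per sr k(1) unfolding torus_fun_def by simp_all
    have "norm (x - y) < 1"
      using near norm_fst_le[of "x - y" "s - r"] by simp
    moreover have "norm (x + k) \<le> norm (x - y) + norm (y + k)"
      using norm_triangle_ineq[of "x - y" "y + k"] by simp
    ultimately have "norm (x + k) \<le> R + 1" "norm (y + k) \<le> R + 1"
      using R[OF k(2)] by linarith+
    moreover have "dist (x + k, s) (y + k, r) < \<delta>"
      using near by (simp add: dist_norm)
    ultimately show "\<bar>v (x, s) - v (y, r)\<bar> < \<gamma>"
      using \<delta>[of "(y + k, r)" "(x + k, s)"] sr unfolding eq by (simp add: dist_real_def)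
  qed
qed

section \<open>One-sided comparison principles\<close>

text \<open>
  The two test functions of this section both contain \<open>\<gamma> * exp (\<kappa> * (s - t))\<close>. For large \<open>\<kappa>\<close> this
  is prohibitive at the final time while being only \<open>\<gamma>\<close> at the time \<open>t\<close> of a hypothetical
  violation, so that the extremum is not at the final time. Its derivative is positive, which
  supplies the strictness on which the contradiction rests.
\<close>

lemma C1_on_doubling_test:
  fixes Y :: "(real ^ 'n) \<times> real"
  shows "C1_on S (\<lambda>z. - k * ((z - Y) \<bullet> (z - Y)) - \<gamma> * exp (\<kappa> * (snd z - t)))
           (\<lambda>z. (- 2 * k) *\<^sub>R (z - Y) - (0, \<gamma> * \<kappa> * exp (\<kappa> * (snd z - t))))"
  unfolding C1_on_def gderiv_def
proof (intro conjI ballI)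
  fix z :: "(real ^ 'n) \<times> real"
  show "((\<lambda>z. - k * ((z - Y) \<bullet> (z - Y)) - \<gamma> * exp (\<kappa> * (snd z - t))) has_derivative
      (\<lambda>h. h \<bullet> ((- 2 * k) *\<^sub>R (z - Y) - (0, \<gamma> * \<kappa> * exp (\<kappa> * (snd z - t)))))) (at z)"
    by (auto intro!: derivative_eq_intros
        simp: fun_eq_iff inner_diff_right inner_commute inner_prod_def algebra_simps)
qed (intro continuous_intros)

lemma C1_on_transport_test:
  fixes x \<alpha> :: "real ^ 'n" and b :: real
  defines "e \<equiv> \<lambda>z :: (real ^ 'n) \<times> real. fst z - x + (b - snd z) *\<^sub>R \<alpha>"
  shows "C1_on S (\<lambda>z. c * (snd z - a) + k * (e z \<bullet> e z) + \<gamma> * exp (\<kappa> * (snd z - t)))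
           (\<lambda>z. ((2 * k) *\<^sub>R e z, c - 2 * k * (e z \<bullet> \<alpha>) + \<gamma> * \<kappa> * exp (\<kappa> * (snd z - t))))"
  unfolding C1_on_def gderiv_def e_def
proof (intro conjI ballI)
  fix z :: "(real ^ 'n) \<times> real"
  show "((\<lambda>z. c * (snd z - a) + k * ((fst z - x + (b - snd z) *\<^sub>R \<alpha>) \<bullet> (fst z - x + (b - snd z) *\<^sub>R \<alpha>))
         + \<gamma> * exp (\<kappa> * (snd z - t))) has_derivative
      (\<lambda>h. h \<bullet> ((2 * k) *\<^sub>R (fst z - x + (b - snd z) *\<^sub>R \<alpha>),
        c - 2 * k * ((fst z - x + (b - snd z) *\<^sub>R \<alpha>) \<bullet> \<alpha>) + \<gamma> * \<kappa> * exp (\<kappa> * (snd z - t))))) (at z)"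
    by (auto intro!: derivative_eq_intros
        simp: fun_eq_iff inner_prod_def inner_diff_left inner_diff_right inner_add_left inner_add_right
          inner_commute algebra_simps)
qed (intro continuous_intros)

text \<open>
  If \<open>v\<close> were smooth, its derivative along the line would be \<open>v\<^sub>s + \<alpha> \<bullet> Dv \<le> V + \<alpha> \<bullet> Dv - H Dv\<close>,
  which is at most \<open>V + l\<close>. In general \<open>v\<close> is touched from above by a function that grows at rate
  \<open>c\<close> along the line and is steep, with coefficient \<open>k\<close>, across it. The penalty \<open>k * \<parallel>e\<parallel>\<^sup>2\<close>, where
  \<open>e\<close> is the distance vector from the line, is constant along the line, so its spatial gradient
  \<open>p\<close> and time derivative \<open>- \<alpha> \<bullet> p\<close> enter the equation only as \<open>H p - \<alpha> \<bullet> p \<ge> - l\<close>.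
\<close>

lemma subsolution_along_line:
  fixes v :: "(real ^ 'n) \<times> real \<Rightarrow> real"
  assumes ab: "0 \<le> a" "a < b" "b \<le> T"
    and cont: "continuous_on (UNIV \<times> {a..b}) v"
    and per: "\<And>s. s \<in> {a..b} \<Longrightarrow> torus_fun (\<lambda>x. v (x, s))"
    and sub: "viscosity_subsolution T (\<lambda>x p. H p - V x) v"
    and Vlip: "\<And>x y. \<bar>V x - V y\<bar> \<le> K * norm (x - y)" and "K \<ge> 0"
    and conj: "\<And>p. \<alpha> \<bullet> p - H p \<le> l"
    and c: "\<And>s. s \<in> {a..b} \<Longrightarrow> l + V (x - (b - s) *\<^sub>R \<alpha>) \<le> c"
  shows "v (x, b) \<le> v (x - (b - a) *\<^sub>R \<alpha>, a) + c * (b - a)"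
proof -
  define X where "X s = x - (b - s) *\<^sub>R \<alpha>" for s
  have main: "v (X t, t) \<le> v (X a, a) + c * (t - a)" if t: "t \<in> {a..<b}" for t
  proof (rule ccontr)
    assume neg: "\<not> v (X t, t) \<le> v (X a, a) + c * (t - a)"
    define \<gamma> where "\<gamma> = (v (X t, t) - v (X a, a) - c * (t - a)) / 4"
    have \<gamma>: "\<gamma> > 0" "v (X t, t) = v (X a, a) + c * (t - a) + 4 * \<gamma>"
      using neg by (auto simp: \<gamma>_def field_simps)
    obtain B0 where B0: "B0 \<ge> 0" "\<And>x s. s \<in> {a..b} \<Longrightarrow> \<bar>v (x, s)\<bar> \<le> B0"
      using periodic_strip_bounded[OF cont per] by blast
    obtain \<delta> where \<delta>: "\<delta> > 0" "\<And>x s y r. s \<in> {a..b} \<Longrightarrow> r \<in> {a..b} \<Longrightarrow>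
        norm ((x, s) - (y, r)) < \<delta> \<Longrightarrow> \<bar>v (x, s) - v (y, r)\<bar> < \<gamma>"
      using periodic_strip_uniformly_continuous[OF cont per \<gamma>(1)] by blast
    define B where "B = 2 * B0 + \<bar>c\<bar> * (b - a)"
    have "B \<ge> 0" using B0(1) ab by (simp add: B_def)
    \<comment> \<open>With this exponent the penalty at the final time \<open>b\<close> exceeds every possible gain.\<close>
    define \<kappa> where "\<kappa> = B / (\<gamma> * (b - t)) + 1"
    have "\<gamma> * (\<kappa> * (b - t)) = B + \<gamma> * (b - t)"
      using \<gamma>(1) t by (simp add: \<kappa>_def distrib_left distrib_right)
    then have \<kappa>: "\<kappa> \<ge> 1" "\<gamma> * (\<kappa> * (b - t)) \<ge> B"
      using \<gamma>(1) t \<open>B \<ge> 0\<close> by (auto simp: \<kappa>_def)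
    define d where "d = \<gamma> * \<kappa> * exp (\<kappa> * (a - t))"
    have "d > 0" using \<gamma>(1) \<kappa>(1) by (simp add: d_def)
    \<comment> \<open>The distance of the maximum point from the line has to be below \<open>\<rho>\<close>, so that neither \<open>v\<close> at
      the initial time nor \<open>V\<close> notices it; \<open>k\<close> is chosen to enforce this.\<close>
    define \<rho> where "\<rho> = min (min \<delta> 1) (d / (K + 1))"
    have \<rho>: "\<rho> > 0" "\<rho> \<le> \<delta>" "\<rho> \<le> 1" "\<rho> \<le> d / (K + 1)"
      using \<open>d > 0\<close> \<delta>(1) \<open>K \<ge> 0\<close> by (auto simp: \<rho>_def)
    define k where "k = (B + 1) / \<rho>\<^sup>2"
    have k: "k > 0" "k * \<rho>\<^sup>2 = B + 1" using \<rho>(1) \<open>B \<ge> 0\<close> by (auto simp: k_def)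
    define e where "e z = fst z - x + (b - snd z) *\<^sub>R \<alpha>" for z :: "(real ^ 'n) \<times> real"
    define \<phi> where "\<phi> z = c * (snd z - a) + k * (e z \<bullet> e z) + \<gamma> * exp (\<kappa> * (snd z - t))" for z
    define r where "r = 2 + (b - a) * norm \<alpha>"
    define S where "S = cball x r \<times> {a..b}"
    have Xr: "norm (X s - x) \<le> r - 2" if "s \<in> {a..b}" for s
      using that by (auto simp: X_def r_def mult_right_mono)
    have cpt: "compact S" by (simp add: S_def compact_Times)
    have "continuous_on S (\<lambda>z. v z - \<phi> z)"
      unfolding \<phi>_def e_def S_def
      by (intro continuous_intros continuous_on_subset[OF cont]) auto
    moreover have XS: "(X t, t) \<in> S"
      using Xr[of t] t by (auto simp: S_def dist_norm norm_minus_commute)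
    ultimately obtain z0 where z0: "z0 \<in> S" "\<And>z. z \<in> S \<Longrightarrow> v z - \<phi> z \<le> v z0 - \<phi> z0"
      using continuous_attains_sup[OF cpt, of "\<lambda>z. v z - \<phi> z"] by blast
    obtain y0 s0 where zz: "z0 = (y0, s0)" by (cases z0)
    have s0: "s0 \<in> {a..b}" using z0(1) by (simp add: S_def zz)
    have e0: "e z0 = y0 - X s0" by (simp add: e_def zz X_def algebra_simps)
    have "e (X t, t) = 0" by (simp add: e_def X_def)
    then have big: "v (X a, a) + 3 * \<gamma> \<le> v z0 - \<phi> z0"
      using z0(2)[OF XS] \<gamma>(2) by (simp add: \<phi>_def)
    have cB: "\<bar>c * (s0 - a)\<bar> \<le> \<bar>c\<bar> * (b - a)"
      using s0 by (auto simp: abs_mult intro!: mult_left_mono)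
    have vB: "v z0 - v (X a, a) \<le> 2 * B0"
      using B0(2)[OF s0, of y0] B0(2)[of a "X a"] ab by (simp add: zz)
    have exp_pos: "\<gamma> * exp (\<kappa> * (s0 - t)) > 0" using \<gamma>(1) by simp
    have \<phi>0: "\<phi> z0 = c * (s0 - a) + k * (norm (y0 - X s0))\<^sup>2 + \<gamma> * exp (\<kappa> * (s0 - t))"
      unfolding \<phi>_def e0 power2_norm_eq_inner by (simp add: zz)
    have "k * (norm (y0 - X s0))\<^sup>2 < k * \<rho>\<^sup>2"
      using big vB cB exp_pos \<gamma>(1) unfolding \<phi>0 k(2) B_def by linarith
    then have near: "norm (y0 - X s0) < \<rho>"
      using k(1) \<rho>(1) by (simp add: power_less_imp_less_base)
    have kn: "k * (e z0 \<bullet> e z0) \<ge> 0" using k(1) by simp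
    have "s0 \<noteq> b"
    proof
      assume "s0 = b"
      have "\<kappa> * (b - t) \<le> exp (\<kappa> * (b - t))"
        using exp_ge_add_one_self[of "\<kappa> * (b - t)"] by linarith
      then have "\<gamma> * (\<kappa> * (b - t)) \<le> \<gamma> * exp (\<kappa> * (b - t))"
        using \<gamma>(1) by (intro mult_left_mono) auto
      then have "\<gamma> * exp (\<kappa> * (s0 - t)) \<ge> B" using \<kappa>(2) \<open>s0 = b\<close> by simp
      then show False
        using big vB cB \<gamma>(1) kn unfolding \<phi>_def B_def zz by (simp add: abs_le_iff)
    qed
    moreover have "s0 \<noteq> a"
    proof
      assume "s0 = a"
      then have "\<bar>v (y0, a) - v (X a, a)\<bar> < \<gamma>"
        using \<delta>(2)[of a a y0 "X a"] near \<rho>(2) ab by simp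
      moreover have "\<phi> z0 > 0"
        using k(1) \<gamma>(1) \<open>s0 = a\<close> by (simp add: \<phi>0 add_nonneg_pos)
      moreover have "v z0 = v (y0, a)" using \<open>s0 = a\<close> by (simp add: zz)
      ultimately show False using big \<gamma>(1) by linarith
    qed
    ultimately have s0': "a < s0" "s0 < b" using s0 by auto
    have "norm (y0 - x) < r"
      using near \<rho>(3) Xr[OF s0] norm_triangle_ineq[of "y0 - X s0" "X s0 - x"] by simp
    then have "z0 \<in> ball x r \<times> {a<..<b}"
      using s0' by (simp add: zz dist_norm norm_minus_commute)
    then have "\<forall>\<^sub>F z in nhds z0. z \<in> ball x r \<times> {a<..<b}"
      by (intro eventually_nhds_in_open open_Times) auto
    then have "\<forall>\<^sub>F z in nhds (y0, s0). v z - \<phi> z \<le> v (y0, s0) - \<phi> (y0, s0)"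
      unfolding zz[symmetric]
    proof (rule eventually_mono)
      fix z assume "z \<in> ball x r \<times> {a<..<b}"
      then show "v z - \<phi> z \<le> v z0 - \<phi> z0" by (intro z0(2)) (auto simp: S_def)
    qed
    moreover note C1_on_transport_test[of "UNIV \<times> {0<..<T}" c a k x b \<alpha> \<gamma> \<kappa> t, folded e_def, folded \<phi>_def]
    moreover have "s0 \<in> {0<..<T}" using s0' ab by simp
    ultimately have "c - 2 * k * (e z0 \<bullet> \<alpha>) + \<gamma> * \<kappa> * exp (\<kappa> * (s0 - t))
        + (H ((2 * k) *\<^sub>R e z0) - V y0) \<le> 0"
      using sub unfolding viscosity_subsolution_def zz by fastforce
    moreover have "2 * k * (e z0 \<bullet> \<alpha>) - H ((2 * k) *\<^sub>R e z0) \<le> l"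
      using conj[of "(2 * k) *\<^sub>R e z0"] by (simp add: inner_commute)
    moreover have "l + V (X s0) \<le> c" using c[OF s0] by (simp add: X_def)
    moreover have "V y0 - V (X s0) < d"
    proof -
      have "V y0 - V (X s0) \<le> K * norm (y0 - X s0)" using Vlip[of y0 "X s0"] by simp
      also have "\<dots> \<le> K * (d / (K + 1))"
        using near \<rho>(4) \<open>K \<ge> 0\<close> by (intro mult_left_mono) auto
      also have "\<dots> < d" using \<open>d > 0\<close> \<open>K \<ge> 0\<close> by (simp add: field_simps)
      finally show ?thesis .
    qed
    moreover have "d \<le> \<gamma> * \<kappa> * exp (\<kappa> * (s0 - t))"
      unfolding d_def using \<gamma>(1) \<kappa>(1) s0 by (intro mult_left_mono) auto
    ultimately show False by linarith
  qed
  \<comment> \<open>The end time may be the boundary \<open>T\<close> of the domain of the equation and is reached by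
    continuity.\<close>
  have "continuous_on {a..b} (\<lambda>s. v (X a, a) + c * (s - a) - v (X s, s))"
    unfolding X_def by (intro continuous_intros continuous_on_compose2[OF cont]) auto
  then have "0 \<le> v (X a, a) + c * (b - a) - v (X b, b)"
    using main ab
    by (intro continuous_ge_on_closure[of "{a..<b}" "\<lambda>s. v (X a, a) + c * (s - a) - v (X s, s)" b 0]) auto
  then show ?thesis by (simp add: X_def)
qed

text \<open>
  Doubling of variables. At a minimum of \<open>v X - Z Y + k * \<parallel>X - Y\<parallel>\<^sup>2\<close> plus a penalty in time, the
  supersolution test at \<open>X\<close> gives \<open>q + H p > V\<close> for \<open>(p, q) = - 2 k (X - Y)\<close>. Moving \<open>Y\<close>
  backwards along a line of velocity \<open>DH p\<close> and using minimality gives \<open>q + H p \<le> V\<close> at the nearby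
  point \<open>Y\<close>, without any test function for \<open>Z\<close>. The Lipschitz bound on \<open>Z\<close> limits \<open>p\<close> to the ball
  of radius \<open>2 * \<Lambda>\<close>, which is why only the velocities \<open>DH p\<close> with such \<open>p\<close> matter.
\<close>

lemma supersolution_ge_line_subsolution:
  fixes v Z :: "(real ^ 'n) \<times> real \<Rightarrow> real" and DH :: "real ^ 'n \<Rightarrow> real ^ 'n"
  assumes ab: "0 \<le> a" "a < b" "b \<le> T"
    and cont: "continuous_on (UNIV \<times> {a..b}) v"
    and per: "\<And>s. s \<in> {a..b} \<Longrightarrow> torus_fun (\<lambda>x. v (x, s))"
    and super: "viscosity_supersolution T (\<lambda>x p. H p - V x) v"
    and Vlip: "\<And>x y. \<bar>V x - V y\<bar> \<le> K * norm (x - y)"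
    and Zper: "\<And>s. s \<in> {a..b} \<Longrightarrow> torus_fun (\<lambda>x. Z (x, s))"
    and Zlip: "\<And>x y s r. s \<in> {a..b} \<Longrightarrow> r \<in> {a..b} \<Longrightarrow>
        \<bar>Z (x, s) - Z (y, r)\<bar> \<le> \<Lambda> * norm (x - y) + \<beta> * \<bar>s - r\<bar>"
    and nonneg: "\<Lambda> \<ge> 0" "\<beta> \<ge> 0" "K \<ge> 0"
    and line: "\<And>x r p \<eta>. a < r \<Longrightarrow> r \<le> b \<Longrightarrow> norm p \<le> 2 * \<Lambda> \<Longrightarrow> 0 < \<eta> \<Longrightarrow> \<eta> \<le> r - a \<Longrightarrow>
        Z (x, r) \<le> Z (x - \<eta> *\<^sub>R DH p, r - \<eta>) + \<eta> * (DH p \<bullet> p - H p + V x)"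
    and init: "\<And>x. Z (x, a) \<le> v (x, a)"
    and s: "s \<in> {a..b}"
  shows "Z (x, s) \<le> v (x, s)"
proof -
  have Zlip': "\<bar>Z X - Z Y\<bar> \<le> (\<Lambda> + \<beta>) * norm (X - Y)" if "snd X \<in> {a..b}" "snd Y \<in> {a..b}" for X Y
  proof -
    have "norm (fst X - fst Y) \<le> norm (X - Y)" "\<bar>snd X - snd Y\<bar> \<le> norm (X - Y)"
      using norm_fst_le[of "fst X - fst Y" "snd X - snd Y"] norm_snd_le[of "snd X - snd Y" "fst X - fst Y"]
      by (auto simp: minus_prod_def)
    then have "\<Lambda> * norm (fst X - fst Y) + \<beta> * \<bar>snd X - snd Y\<bar> \<le> \<Lambda> * norm (X - Y) + \<beta> * norm (X - Y)"
      using nonneg by (intro add_mono mult_left_mono) auto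
    then show ?thesis
      using Zlip[OF that, of "fst X" "fst Y"] by (simp add: distrib_right)
  qed
  have Zcont: "continuous_on (UNIV \<times> {a..b}) Z"
  proof (rule lipschitz_on_continuous_on)
    show "(\<Lambda> + \<beta>)-lipschitz_on (UNIV \<times> {a..b}) Z"
      using Zlip' nonneg by (intro lipschitz_onI) (auto simp: dist_norm)
  qed
  have main: "Z (x, s) \<le> v (x, s)" if s: "s \<in> {a..<b}" for x s
  proof (rule ccontr)
    assume neg: "\<not> Z (x, s) \<le> v (x, s)"
    define \<gamma> where "\<gamma> = (Z (x, s) - v (x, s)) / 4"
    have \<gamma>: "\<gamma> > 0" "v (x, s) - Z (x, s) = - 4 * \<gamma>"
      using neg by (auto simp: \<gamma>_def)
    obtain B1 where B1: "B1 \<ge> 0" "\<And>x s. s \<in> {a..b} \<Longrightarrow> \<bar>v (x, s)\<bar> \<le> B1"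
      using periodic_strip_bounded[OF cont per] by blast
    obtain B2 where B2: "B2 \<ge> 0" "\<And>x s. s \<in> {a..b} \<Longrightarrow> \<bar>Z (x, s)\<bar> \<le> B2"
      using periodic_strip_bounded[OF Zcont Zper] by blast
    obtain \<delta> where \<delta>: "\<delta> > 0" "\<And>x s y r. s \<in> {a..b} \<Longrightarrow> r \<in> {a..b} \<Longrightarrow>
        norm ((x, s) - (y, r)) < \<delta> \<Longrightarrow> \<bar>v (x, s) - v (y, r)\<bar> < \<gamma>"
      using periodic_strip_uniformly_continuous[OF cont per \<gamma>(1)] by blast
    define B where "B = B1 + B2"
    have B: "B \<ge> 0" "B1 \<le> B" using B1(1) B2(1) by (auto simp: B_def)
    \<comment> \<open>With this exponent the penalty at the final time \<open>b\<close> exceeds every possible gain.\<close>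
    define \<kappa> where "\<kappa> = B / (\<gamma> * (b - s)) + 1"
    have "\<gamma> * (\<kappa> * (b - s)) = B + \<gamma> * (b - s)"
      using \<gamma>(1) s by (simp add: \<kappa>_def distrib_left distrib_right)
    then have \<kappa>: "\<kappa> \<ge> 1" "\<gamma> * (\<kappa> * (b - s)) \<ge> B"
      using \<gamma>(1) s B by (auto simp: \<kappa>_def)
    define d where "d = \<gamma> * \<kappa> * exp (\<kappa> * (a - s))"
    have "d > 0" using \<gamma>(1) \<kappa>(1) by (simp add: d_def)
    \<comment> \<open>The two points have to be closer than \<open>\<rho>\<close>, so that neither the initial inequality nor \<open>V\<close>
      notices the difference; \<open>k\<close> is chosen to enforce this.\<close>
    define \<rho> where "\<rho> = min (min \<delta> (\<gamma> / (\<Lambda> + \<beta> + 1))) (d / (K + 1))"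
    have \<rho>: "\<rho> > 0" "\<rho> \<le> \<delta>" "\<rho> \<le> \<gamma> / (\<Lambda> + \<beta> + 1)" "\<rho> \<le> d / (K + 1)"
      using \<open>d > 0\<close> \<delta>(1) nonneg \<gamma>(1) by (auto simp: \<rho>_def)
    define k where "k = (B + 1) / \<rho>\<^sup>2"
    have k: "k > 0" "k * \<rho>\<^sup>2 = B + 1" using \<rho>(1) B by (auto simp: k_def)
    \<comment> \<open>Points further apart than \<open>M\<close> do no better than points closer together. The minimum over a compact set is therefore
      global by periodicity, which permits moving \<open>Y\<close> out of the unit cube below.\<close>
    define M where "M = 1 + 2 * B / k"
    have M: "M \<ge> 1" "k * M\<^sup>2 \<ge> 2 * B"
    proof -
      show "M \<ge> 1" using B k by (simp add: M_def)
      then have "k * M \<le> k * M\<^sup>2"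
        using k by (intro mult_left_mono) (auto simp: power2_eq_square)
      moreover have "k * M = k + 2 * B" using k by (simp add: M_def field_simps)
      ultimately show "k * M\<^sup>2 \<ge> 2 * B" using k by simp
    qed
    define P where "P \<sigma> = \<gamma> * exp (\<kappa> * (\<sigma> - s))" for \<sigma>
    have P_pos: "P \<sigma> > 0" for \<sigma> using \<gamma>(1) by (simp add: P_def)
    define \<Phi> where "\<Phi> X Y = v X - Z Y + k * (norm (X - Y))\<^sup>2 + P (snd X)" for X Y
    obtain R where R: "\<And>x :: real ^ 'n. x \<in> cbox 0 1 \<Longrightarrow> norm x \<le> R"
      using unit_cube_in_ball by blast
    define S where "S = cball (0 :: real ^ 'n) (R + M) \<times> {a..b}"
    define Q where "Q = cbox (0 :: real ^ 'n) 1 \<times> {a..b}"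
    have Q_S: "Q \<subseteq> S" using R M(1) by (force simp: Q_def S_def)
    have "compact (S \<times> Q)" by (simp add: S_def Q_def compact_Times)
    moreover have "S \<times> Q \<noteq> {}"
    proof -
      have "(0, a) \<in> Q" using ab by (simp add: Q_def mem_box_cart)
      then show ?thesis using Q_S by blast
    qed
    moreover have "continuous_on (S \<times> Q) (\<lambda>W. \<Phi> (fst W) (snd W))"
      unfolding \<Phi>_def P_def
      by (intro continuous_intros continuous_on_compose2[OF cont] continuous_on_compose2[OF Zcont])
         (auto simp: S_def Q_def)
    ultimately obtain W where W: "W \<in> S \<times> Q" "\<And>W'. W' \<in> S \<times> Q \<Longrightarrow> \<Phi> (fst W) (snd W) \<le> \<Phi> (fst W') (snd W')"
      using continuous_attains_inf[of "S \<times> Q" "\<lambda>W. \<Phi> (fst W) (snd W)"] by blast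
    obtain x0 s0 y0 r0 where WW: "W = ((x0, s0), (y0, r0))" by (metis surj_pair)
    have s0: "s0 \<in> {a..b}" and r0: "r0 \<in> {a..b}" using W(1) by (auto simp: WW S_def Q_def)
    define m where "m = \<Phi> (x0, s0) (y0, r0)"
    have local_min: "m \<le> \<Phi> X Y" if "X \<in> S" "Y \<in> Q" for X Y
      using W(2)[of "(X, Y)"] that by (simp add: m_def WW)
    have global_min: "m \<le> \<Phi> (x, \<sigma>) (y, r)" if \<sigma>: "\<sigma> \<in> {a..b}" and r: "r \<in> {a..b}" for x y \<sigma> r
    proof -
      obtain e :: "real ^ 'n" where e: "\<forall>j. e $ j \<in> \<int>" "y + e \<in> cbox 0 1"
        by (rule integer_shift_into_unit_cube)
      have shift: "\<Phi> (x + e, \<sigma>) (y + e, r) = \<Phi> (x, \<sigma>) (y, r)"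
        using per[OF \<sigma>] Zper[OF r] e(1) by (simp add: \<Phi>_def torus_fun_def)
      have yQ: "(y + e, r) \<in> Q" using e r by (simp add: Q_def)
      show ?thesis
      proof (cases "norm (x + e) \<le> R + M")
        case True
        then have "m \<le> \<Phi> (x + e, \<sigma>) (y + e, r)" using yQ \<sigma> by (intro local_min) (auto simp: S_def)
        then show ?thesis using shift by simp
      next
        case False
        have "norm (x + e) \<le> norm (x - y) + norm (y + e)"
          using norm_triangle_ineq[of "x - y" "y + e"] by simp
        then have "M \<le> norm (x - y)" using False R[OF e(2)] by simp
        then have "M\<^sup>2 \<le> (norm (x - y))\<^sup>2" using M(1) by (intro power_mono) auto
        then have "2 * B \<le> k * (norm (x - y))\<^sup>2"
          using M(2) k(1) by (meson less_imp_le mult_left_mono order_trans)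
        moreover have "(norm ((x, \<sigma>) - (y, r)))\<^sup>2 = (norm (x - y))\<^sup>2 + (norm ((y + e, \<sigma>) - (y + e, r)))\<^sup>2"
          by (simp add: norm_Pair)
        moreover have "v (y + e, \<sigma>) - v (x, \<sigma>) \<le> 2 * B"
          using B1(2)[OF \<sigma>, of x] B1(2)[OF \<sigma>, of "y + e"] B(2) by linarith
        moreover have "Z (y + e, r) = Z (y, r)" using Zper[OF r] e(1) by (simp add: torus_fun_def)
        ultimately have "\<Phi> (y + e, \<sigma>) (y + e, r) \<le> \<Phi> (x, \<sigma>) (y, r)"
          by (simp add: \<Phi>_def distrib_left)
        moreover have "(y + e, \<sigma>) \<in> S" using Q_S e(2) \<sigma> by (auto simp: Q_def)
        then have "m \<le> \<Phi> (y + e, \<sigma>) (y + e, r)" by (rule local_min[OF _ yQ])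
        ultimately show ?thesis by simp
      qed
    qed
    define D where "D = (x0, s0) - (y0, r0)"
    have m: "m = v (x0, s0) - Z (y0, r0) + k * (norm D)\<^sup>2 + P s0" by (simp add: m_def \<Phi>_def D_def)
    have "m \<le> - 3 * \<gamma>"
      using global_min[of s s x x] s \<gamma>(2) by (simp add: \<Phi>_def P_def)
    then have m_neg: "v (x0, s0) - Z (y0, r0) + k * (norm D)\<^sup>2 + P s0 \<le> - 3 * \<gamma>" by (simp add: m)
    have vZ: "v (x0, s0) - Z (y0, r0) \<ge> - B"
      using B1(2)[OF s0, of x0] B2(2)[OF r0, of y0] unfolding B_def by linarith
    have "k * (norm D)\<^sup>2 < k * \<rho>\<^sup>2"
      using m_neg vZ P_pos[of s0] \<gamma>(1) unfolding k(2) by simp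
    then have near: "norm D < \<rho>"
      using k(1) \<rho>(1) by (simp add: power_less_imp_less_base)
    have kn: "k * (norm D)\<^sup>2 \<ge> 0" using k(1) by simp
    have vZ_neg: "v (x0, s0) - Z (y0, r0) < - \<gamma>"
      using m_neg kn P_pos[of s0] \<gamma>(1) by linarith
    have "s0 \<noteq> b"
    proof
      assume "s0 = b"
      have "\<kappa> * (b - s) \<le> exp (\<kappa> * (b - s))"
        using exp_ge_add_one_self[of "\<kappa> * (b - s)"] by linarith
      then have "\<gamma> * (\<kappa> * (b - s)) \<le> \<gamma> * exp (\<kappa> * (b - s))"
        using \<gamma>(1) by (intro mult_left_mono) auto
      then have "P s0 \<ge> B" using \<kappa>(2) \<open>s0 = b\<close> by (simp add: P_def)
      then show False using m_neg vZ \<gamma>(1) kn by linarith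
    qed
    moreover have "s0 \<noteq> a"
    proof
      assume "s0 = a"
      have "\<bar>Z (x0, s0) - Z (y0, r0)\<bar> \<le> (\<Lambda> + \<beta>) * norm D"
        using Zlip'[of "(x0, s0)" "(y0, r0)"] s0 r0 by (simp add: D_def)
      also have "\<dots> \<le> (\<Lambda> + \<beta> + 1) * (\<gamma> / (\<Lambda> + \<beta> + 1))"
        using near \<rho>(3) nonneg by (intro mult_mono) auto
      also have "\<dots> = \<gamma>" using nonneg by simp
      finally show False using init[of x0] vZ_neg \<open>s0 = a\<close> by simp
    qed
    moreover have "r0 \<noteq> a"
    proof
      assume "r0 = a"
      have "\<bar>v (x0, s0) - v (y0, r0)\<bar> < \<gamma>"
        using \<delta>(2)[OF s0 r0, of x0 y0] near \<rho>(2) by (simp add: D_def)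
      then show False using init[of y0] vZ_neg \<open>r0 = a\<close> by simp
    qed
    ultimately have s0': "a < s0" "s0 < b" and r0': "a < r0" "r0 \<le> b" using s0 r0 by auto
    define p where "p = (- 2 * k) *\<^sub>R (x0 - y0)"
    define q where "q = (- 2 * k) * (s0 - r0)"
    have p_bound: "norm p \<le> 2 * \<Lambda>"
    proof -
      have "m \<le> \<Phi> (x0, s0) (x0, r0)" by (rule global_min[OF s0 r0])
      then have "k * (norm (x0 - y0))\<^sup>2 \<le> Z (y0, r0) - Z (x0, r0)"
        by (simp add: m D_def \<Phi>_def norm_Pair distrib_left)
      also have "\<dots> \<le> \<Lambda> * norm (x0 - y0)"
        using Zlip[OF r0 r0, of y0 x0] by (simp add: norm_minus_commute)
      finally have "(k * norm (x0 - y0)) * norm (x0 - y0) \<le> \<Lambda> * norm (x0 - y0)"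
        by (simp add: power2_eq_square)
      then have "k * norm (x0 - y0) \<le> \<Lambda>"
        using nonneg(1) by (cases "x0 = y0") auto
      then show ?thesis using k(1) by (simp add: p_def)
    qed
    have "V x0 + d \<le> q + H p"
    proof -
      define \<phi> where "\<phi> z = - k * ((z - (y0, r0)) \<bullet> (z - (y0, r0))) - \<gamma> * exp (\<kappa> * (snd z - s))" for z
      have "\<forall>\<^sub>F z in nhds (x0, s0). z \<in> UNIV \<times> {a<..<b}"
        using s0' by (intro eventually_nhds_in_open open_Times) auto
      then have "\<forall>\<^sub>F z in nhds (x0, s0). v z - \<phi> z \<ge> v (x0, s0) - \<phi> (x0, s0)"
      proof (rule eventually_mono)
        fix z :: "(real ^ 'n) \<times> real" assume "z \<in> UNIV \<times> {a<..<b}"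
        then have "m \<le> \<Phi> (fst z, snd z) (y0, r0)" by (intro global_min[OF _ r0]) auto
        then show "v z - \<phi> z \<ge> v (x0, s0) - \<phi> (x0, s0)"
          by (simp add: m \<Phi>_def D_def \<phi>_def P_def power2_norm_eq_inner del: diff_Pair)
      qed
      moreover note C1_on_doubling_test[of "UNIV \<times> {0<..<T}" k "(y0, r0)" \<gamma> \<kappa> s, folded \<phi>_def]
      moreover have "s0 \<in> {0<..<T}" using s0' ab by simp
      ultimately have "q - \<gamma> * \<kappa> * exp (\<kappa> * (s0 - s)) + (H p - V x0) \<ge> 0"
        using super unfolding viscosity_supersolution_def p_def q_def by fastforce
      moreover have "d \<le> \<gamma> * \<kappa> * exp (\<kappa> * (s0 - s))"
        unfolding d_def using \<gamma>(1) \<kappa>(1) s0 by (intro mult_left_mono) auto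
      ultimately show ?thesis by linarith
    qed
    moreover have "q + H p \<le> V y0"
    proof (rule ccontr)
      assume "\<not> q + H p \<le> V y0"
      define \<alpha> where "\<alpha> = DH p"
      define A where "A = k * ((norm \<alpha>)\<^sup>2 + 1)"
      have "A > 0" using k(1) by (simp add: A_def add_nonneg_pos)
      define g where "g = q + H p - V y0"
      have "g > 0" using \<open>\<not> q + H p \<le> V y0\<close> by (simp add: g_def)
      define \<eta> where "\<eta> = min (r0 - a) (g / (2 * A))"
      have \<eta>: "0 < \<eta>" "\<eta> \<le> r0 - a" "\<eta> * A < g"
      proof -
        show "0 < \<eta>" using r0' \<open>g > 0\<close> \<open>A > 0\<close> by (simp add: \<eta>_def)
        have "\<eta> * A \<le> g / (2 * A) * A" using \<open>A > 0\<close> by (intro mult_right_mono) (auto simp: \<eta>_def)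
        also have "\<dots> < g" using \<open>A > 0\<close> \<open>g > 0\<close> by simp
        finally show "\<eta> * A < g" .
      qed (simp add: \<eta>_def)
      have "m \<le> \<Phi> (x0, s0) (y0 - \<eta> *\<^sub>R \<alpha>, r0 - \<eta>)"
        using \<eta> r0 by (intro global_min[OF s0]) auto
      moreover have "(norm ((x0, s0) - (y0 - \<eta> *\<^sub>R \<alpha>, r0 - \<eta>)))\<^sup>2
          = (norm D)\<^sup>2 + 2 * \<eta> * ((x0 - y0) \<bullet> \<alpha> + (s0 - r0)) + \<eta>\<^sup>2 * ((norm \<alpha>)\<^sup>2 + 1)"
        unfolding D_def power2_norm_eq_inner
        by (simp add: inner_diff_left inner_diff_right inner_commute power2_eq_square algebra_simps)
      ultimately have "Z (y0 - \<eta> *\<^sub>R \<alpha>, r0 - \<eta>)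
          \<le> Z (y0, r0) + k * (2 * \<eta> * ((x0 - y0) \<bullet> \<alpha> + (s0 - r0)) + \<eta>\<^sup>2 * ((norm \<alpha>)\<^sup>2 + 1))"
        by (simp add: m \<Phi>_def distrib_left)
      also have "k * (2 * \<eta> * ((x0 - y0) \<bullet> \<alpha> + (s0 - r0)) + \<eta>\<^sup>2 * ((norm \<alpha>)\<^sup>2 + 1))
          = \<eta> * (\<eta> * A - (p \<bullet> \<alpha> + q))"
        by (simp add: p_def q_def A_def power2_eq_square algebra_simps)
      finally have "Z (y0 - \<eta> *\<^sub>R \<alpha>, r0 - \<eta>) \<le> Z (y0, r0) + \<eta> * (\<eta> * A - (p \<bullet> \<alpha> + q))" by simp
      moreover have "Z (y0, r0) \<le> Z (y0 - \<eta> *\<^sub>R \<alpha>, r0 - \<eta>) + \<eta> * (\<alpha> \<bullet> p - H p + V y0)"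
        unfolding \<alpha>_def using r0' p_bound \<eta> by (intro line) auto
      ultimately have "0 \<le> \<eta> * (\<eta> * A - (p \<bullet> \<alpha> + q)) + \<eta> * (\<alpha> \<bullet> p - H p + V y0)" by linarith
      also have "\<dots> = \<eta> * (\<eta> * A - g)" by (simp add: g_def inner_commute algebra_simps)
      finally have "0 \<le> \<eta> * A - g" using \<eta>(1) by (simp add: zero_le_mult_iff)
      then show False using \<eta>(3) by simp
    qed
    moreover have "V y0 - V x0 < d"
    proof -
      have "norm (x0 - y0) \<le> norm D" using norm_fst_le[of "x0 - y0" "s0 - r0"] by (simp add: D_def)
      then have "V y0 - V x0 \<le> K * norm D"
        using Vlip[of x0 y0] mult_left_mono[of "norm (x0 - y0)" "norm D" K] nonneg(3) by linarith
      also have "\<dots> \<le> K * (d / (K + 1))"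
        using near \<rho>(4) nonneg by (intro mult_left_mono) auto
      also have "\<dots> < d" using \<open>d > 0\<close> nonneg by (simp add: field_simps)
      finally show ?thesis .
    qed
    ultimately show False by linarith
  qed
  \<comment> \<open>The end time may be the boundary \<open>T\<close> of the domain of the equation and is reached by
    continuity.\<close>
  have "continuous_on {a..b} (\<lambda>s. v (x, s) - Z (x, s))"
    by (intro continuous_intros continuous_on_compose2[OF cont] continuous_on_compose2[OF Zcont]) auto
  then have "0 \<le> v (x, s) - Z (x, s)"
    using main ab s
    by (intro continuous_ge_on_closure[of "{a..<b}" "\<lambda>s. v (x, s) - Z (x, s)" s 0]) auto
  then show ?thesis by simp
qed

section \<open>The Hopf-Lax operator with bounded controls\<close>

definition hopf_lax ::
    "(real ^ 'n) set \<Rightarrow> (real ^ 'n \<Rightarrow> real) \<Rightarrow> real \<Rightarrow> (real ^ 'n \<Rightarrow> real) \<Rightarrow> real ^ 'n \<Rightarrow> real" where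
  "hopf_lax A L t \<phi> x = (INF \<alpha>\<in>A. \<phi> (x - t *\<^sub>R \<alpha>) + t * L \<alpha>)"

lemma cINF_close:
  fixes f g :: "'a \<Rightarrow> real"
  assumes "A \<noteq> {}" and "\<And>a. a \<in> A \<Longrightarrow> \<bar>f a - g a\<bar> \<le> e"
    and "bdd_below (f ` A)" "bdd_below (g ` A)"
  shows "\<bar>(INF a\<in>A. f a) - (INF a\<in>A. g a)\<bar> \<le> e"
proof -
  have "(INF a\<in>A. f a) - e \<le> (INF a\<in>A. g a)"
  proof (rule cINF_greatest[OF assms(1)])
    fix a assume a: "a \<in> A"
    show "(INF a\<in>A. f a) - e \<le> g a" using cINF_lower[OF assms(3) a] assms(2)[OF a] by linarith
  qed
  moreover have "(INF a\<in>A. g a) - e \<le> (INF a\<in>A. f a)"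
  proof (rule cINF_greatest[OF assms(1)])
    fix a assume a: "a \<in> A"
    show "(INF a\<in>A. g a) - e \<le> f a" using cINF_lower[OF assms(4) a] assms(2)[OF a] by linarith
  qed
  ultimately show ?thesis by linarith
qed

locale bounded_controls =
  fixes L :: "real ^ 'n \<Rightarrow> real" and R B :: real
  assumes R_nonneg: "R \<ge> 0"
    and L_bounded: "norm \<alpha> \<le> R \<Longrightarrow> \<bar>L \<alpha>\<bar> \<le> B"
    and L_convex: "convex_on UNIV L"
begin

abbreviation ball_hopf_lax :: "real \<Rightarrow> (real ^ 'n \<Rightarrow> real) \<Rightarrow> real ^ 'n \<Rightarrow> real" where
  "ball_hopf_lax \<equiv> hopf_lax (cball 0 R) L"

lemma ball_nonempty: "cball (0 :: real ^ 'n) R \<noteq> {}"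
  using R_nonneg by simp

lemma bdd_below_controls:
  assumes lip: "\<And>x y. \<bar>\<phi> x - \<phi> y\<bar> \<le> \<Lambda> * norm (x - y)" and "\<Lambda> \<ge> 0" "t \<ge> 0"
  shows "bdd_below ((\<lambda>\<alpha>. \<phi> (x - t *\<^sub>R \<alpha>) + t * L \<alpha>) ` cball 0 R)"
proof (rule bdd_belowI2)
  fix \<alpha> :: "real ^ 'n" assume "\<alpha> \<in> cball 0 R"
  then have \<alpha>: "norm \<alpha> \<le> R" by simp
  have "\<Lambda> * (t * norm \<alpha>) \<le> \<Lambda> * (t * R)"
    using \<alpha> assms(2,3) by (intro mult_left_mono) auto
  moreover have "t * (- B) \<le> t * L \<alpha>"
    using L_bounded[OF \<alpha>] assms(3) by (intro mult_left_mono) auto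
  ultimately show "\<phi> x - \<Lambda> * (t * R) + t * (- B) \<le> \<phi> (x - t *\<^sub>R \<alpha>) + t * L \<alpha>"
    using lip[of x "x - t *\<^sub>R \<alpha>"] assms(3) by simp
qed

lemma ball_hopf_lax_le:
  assumes "\<And>x y. \<bar>\<phi> x - \<phi> y\<bar> \<le> \<Lambda> * norm (x - y)" "\<Lambda> \<ge> 0" "t \<ge> 0" "norm \<alpha> \<le> R"
  shows "ball_hopf_lax t \<phi> x \<le> \<phi> (x - t *\<^sub>R \<alpha>) + t * L \<alpha>"
  unfolding hopf_lax_def by (rule cINF_lower[OF bdd_below_controls[OF assms(1-3)]]) (use assms(4) in simp)

lemma ball_hopf_lax_greatest:
  assumes "\<And>\<alpha>. norm \<alpha> \<le> R \<Longrightarrow> c \<le> \<phi> (x - t *\<^sub>R \<alpha>) + t * L \<alpha>"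
  shows "c \<le> ball_hopf_lax t \<phi> x"
  unfolding hopf_lax_def by (rule cINF_greatest[OF ball_nonempty]) (use assms in simp)

lemma ball_hopf_lax_lipschitz:
  assumes lip: "\<And>x y. \<bar>\<phi> x - \<phi> y\<bar> \<le> \<Lambda> * norm (x - y)" and \<Lambda>: "\<Lambda> \<ge> 0" and t: "t \<ge> 0" "s \<ge> 0"
  shows "\<bar>ball_hopf_lax t \<phi> x - ball_hopf_lax s \<phi> y\<bar> \<le> \<Lambda> * norm (x - y) + (\<Lambda> * R + B) * \<bar>t - s\<bar>"
  unfolding hopf_lax_def
proof (rule cINF_close[OF ball_nonempty])
  fix \<alpha> :: "real ^ 'n" assume "\<alpha> \<in> cball 0 R"
  then have \<alpha>: "norm \<alpha> \<le> R" by simp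
  have split: "(x - t *\<^sub>R \<alpha>) - (y - s *\<^sub>R \<alpha>) = (x - y) - (t - s) *\<^sub>R \<alpha>"
    by (simp add: algebra_simps)
  have "norm ((x - t *\<^sub>R \<alpha>) - (y - s *\<^sub>R \<alpha>)) \<le> norm (x - y) + \<bar>t - s\<bar> * norm \<alpha>"
    unfolding split using norm_triangle_ineq4[of "x - y" "(t - s) *\<^sub>R \<alpha>"] by simp
  also have "\<dots> \<le> norm (x - y) + \<bar>t - s\<bar> * R"
    using \<alpha> by (intro add_left_mono mult_left_mono) auto
  finally have "\<Lambda> * norm ((x - t *\<^sub>R \<alpha>) - (y - s *\<^sub>R \<alpha>)) \<le> \<Lambda> * (norm (x - y) + \<bar>t - s\<bar> * R)"
    using \<Lambda> by (rule mult_left_mono)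
  moreover have "\<bar>t * L \<alpha> - s * L \<alpha>\<bar> \<le> \<bar>t - s\<bar> * B"
    using L_bounded[OF \<alpha>] by (simp add: left_diff_distrib[symmetric] abs_mult mult_left_mono)
  ultimately show "\<bar>\<phi> (x - t *\<^sub>R \<alpha>) + t * L \<alpha> - (\<phi> (y - s *\<^sub>R \<alpha>) + s * L \<alpha>)\<bar>
      \<le> \<Lambda> * norm (x - y) + (\<Lambda> * R + B) * \<bar>t - s\<bar>"
    using lip[of "x - t *\<^sub>R \<alpha>" "y - s *\<^sub>R \<alpha>"] by (simp add: algebra_simps)
qed (rule bdd_below_controls[OF lip \<Lambda>]; fact)+

lemma ball_hopf_lax_periodic:
  assumes "torus_fun \<phi>"
  shows "torus_fun (ball_hopf_lax t \<phi>)"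
proof -
  have "\<phi> (x + k - t *\<^sub>R \<alpha>) = \<phi> (x - t *\<^sub>R \<alpha>)" if "\<forall>j. k $ j \<in> \<int>" for x k \<alpha>
    using assms that unfolding torus_fun_def by (metis add_diff_eq add.commute diff_add_eq)
  then show ?thesis by (simp add: torus_fun_def hopf_lax_def)
qed

lemma ball_hopf_lax_0: "ball_hopf_lax 0 \<phi> x = \<phi> x"
  using ball_nonempty by (simp add: hopf_lax_def)

text \<open>
  A control \<open>\<beta>\<close> used for the time \<open>t - \<eta>\<close> and \<open>\<alpha>\<close> for the time \<open>\<eta>\<close> lead to the same point as
  their weighted mean used for the time \<open>t\<close>, which is admissible since the ball is convex and is
  no more expensive since \<open>L\<close> is convex.
\<close>

lemma ball_hopf_lax_line:
  assumes lip: "\<And>x y. \<bar>\<phi> x - \<phi> y\<bar> \<le> \<Lambda> * norm (x - y)" and \<Lambda>: "\<Lambda> \<ge> 0"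
    and \<alpha>: "norm \<alpha> \<le> R" and \<eta>: "0 < \<eta>" "\<eta> \<le> t"
  shows "ball_hopf_lax t \<phi> x \<le> ball_hopf_lax (t - \<eta>) \<phi> (x - \<eta> *\<^sub>R \<alpha>) + \<eta> * L \<alpha>"
proof -
  have "ball_hopf_lax t \<phi> x - \<eta> * L \<alpha> \<le> ball_hopf_lax (t - \<eta>) \<phi> (x - \<eta> *\<^sub>R \<alpha>)"
  proof (rule ball_hopf_lax_greatest)
    fix \<beta> :: "real ^ 'n" assume \<beta>: "norm \<beta> \<le> R"
    define \<theta> where "\<theta> = \<eta> / t"
    have \<theta>: "0 \<le> \<theta>" "\<theta> \<le> 1" "t * \<theta> = \<eta>" "t * (1 - \<theta>) = t - \<eta>"
      using \<eta> by (auto simp: \<theta>_def right_diff_distrib)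
    define \<gamma> where "\<gamma> = (1 - \<theta>) *\<^sub>R \<beta> + \<theta> *\<^sub>R \<alpha>"
    have "\<gamma> \<in> cball 0 R"
      unfolding \<gamma>_def using \<alpha> \<beta> \<theta> by (intro convexD[OF convex_cball]) auto
    then have "norm \<gamma> \<le> R" by simp
    then have "ball_hopf_lax t \<phi> x \<le> \<phi> (x - t *\<^sub>R \<gamma>) + t * L \<gamma>"
      using \<eta> by (intro ball_hopf_lax_le[OF lip \<Lambda>]) auto
    moreover have "t *\<^sub>R \<gamma> = (t * (1 - \<theta>)) *\<^sub>R \<beta> + (t * \<theta>) *\<^sub>R \<alpha>"
      by (simp add: \<gamma>_def scaleR_add_right)
    then have "x - t *\<^sub>R \<gamma> = x - \<eta> *\<^sub>R \<alpha> - (t - \<eta>) *\<^sub>R \<beta>"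
      unfolding \<theta>(3,4) by simp
    moreover have "t * L \<gamma> \<le> (t * (1 - \<theta>)) * L \<beta> + (t * \<theta>) * L \<alpha>"
    proof -
      have "L \<gamma> \<le> (1 - \<theta>) * L \<beta> + \<theta> * L \<alpha>"
        unfolding \<gamma>_def using \<theta> by (intro convex_onD[OF L_convex]) auto
      from mult_left_mono[OF this, of t] \<eta> show ?thesis by (simp add: distrib_left mult.assoc)
    qed
    ultimately show "ball_hopf_lax t \<phi> x - \<eta> * L \<alpha> \<le> \<phi> (x - \<eta> *\<^sub>R \<alpha> - (t - \<eta>) *\<^sub>R \<beta>) + (t - \<eta>) * L \<beta>"
      unfolding \<theta>(3,4) by simp
  qed
  then show ?thesis by simp
qed

text \<open>
  A control outside the ball is beaten by the zero control: what it can gain, \<open>t * \<Lambda> * \<parallel>\<alpha>\<parallel>\<close>, is at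
  most its extra cost.
\<close>

lemma large_controls_useless:
  assumes lip: "\<And>x y. \<bar>\<phi> x - \<phi> y\<bar> \<le> \<Lambda> * norm (x - y)"
    and coercive: "\<And>\<alpha>. R \<le> norm \<alpha> \<Longrightarrow> L 0 + \<Lambda> * norm \<alpha> \<le> L \<alpha>" and t: "t \<ge> 0" and \<Lambda>: "\<Lambda> \<ge> 0"
  shows "bdd_below (range (\<lambda>\<alpha>. \<phi> (x - t *\<^sub>R \<alpha>) + t * L \<alpha>))"
    and "(INF \<alpha>. \<phi> (x - t *\<^sub>R \<alpha>) + t * L \<alpha>) = ball_hopf_lax t \<phi> x"
proof -
  have le: "ball_hopf_lax t \<phi> x \<le> \<phi> (x - t *\<^sub>R \<alpha>) + t * L \<alpha>" for \<alpha>
  proof (cases "norm \<alpha> \<le> R")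
    case True
    then show ?thesis by (rule ball_hopf_lax_le[OF lip \<Lambda> t])
  next
    case False
    have "ball_hopf_lax t \<phi> x \<le> \<phi> x + t * L 0"
      using ball_hopf_lax_le[OF lip \<Lambda> t, of 0 x] R_nonneg by simp
    moreover have "t * (L 0 + \<Lambda> * norm \<alpha>) \<le> t * L \<alpha>"
      using coercive[of \<alpha>] False t by (intro mult_left_mono) auto
    ultimately show ?thesis
      using lip[of x "x - t *\<^sub>R \<alpha>"] t by (simp add: algebra_simps)
  qed
  then show bdd: "bdd_below (range (\<lambda>\<alpha>. \<phi> (x - t *\<^sub>R \<alpha>) + t * L \<alpha>))"
    by (intro bdd_belowI2)
  show "(INF \<alpha>. \<phi> (x - t *\<^sub>R \<alpha>) + t * L \<alpha>) = ball_hopf_lax t \<phi> x"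
  proof (rule antisym)
    show "(INF \<alpha>. \<phi> (x - t *\<^sub>R \<alpha>) + t * L \<alpha>) \<le> ball_hopf_lax t \<phi> x"
      by (intro ball_hopf_lax_greatest cINF_lower[OF bdd]) simp
    show "ball_hopf_lax t \<phi> x \<le> (INF \<alpha>. \<phi> (x - t *\<^sub>R \<alpha>) + t * L \<alpha>)"
      by (intro cINF_greatest le) simp
  qed
qed

end

section \<open>Splitting in time and the three error estimates\<close>

text \<open>
  Here \<open>G\<close> and \<open>K\<close> are Lipschitz constants of the data, and \<open>G + T * K\<close> is one for all iterates up
  to time \<open>T\<close>; \<open>R\<close> has to be large enough for this slope and can therefore be chosen before the
  step size.
\<close>

locale time_stepping = bounded_controls L R B
  for L :: "real ^ 'n \<Rightarrow> real" and R B +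
  fixes V g :: "real ^ 'n \<Rightarrow> real" and K G T :: real
  assumes V_periodic: "torus_fun V" and g_periodic: "torus_fun g"
    and V_lipschitz: "\<bar>V x - V y\<bar> \<le> K * norm (x - y)" and K_nonneg: "K \<ge> 0"
    and g_lipschitz: "\<bar>g x - g y\<bar> \<le> G * norm (x - y)" and G_nonneg: "G \<ge> 0"
    and coercive: "R \<le> norm \<alpha> \<Longrightarrow> L 0 + (G + T * K) * norm \<alpha> \<le> L \<alpha>"
begin

primrec semi_discrete :: "real \<Rightarrow> nat \<Rightarrow> real ^ 'n \<Rightarrow> real" where
  "semi_discrete dt 0 = g"
| "semi_discrete dt (Suc k) = (\<lambda>x. ball_hopf_lax dt (semi_discrete dt k) x + dt * V x)"

lemma semi_discrete_periodic: "torus_fun (semi_discrete dt k)"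
proof (induction k)
  case (Suc k)
  then show ?case using ball_hopf_lax_periodic[OF Suc] V_periodic by (simp add: torus_fun_def)
qed (simp add: g_periodic)

lemma semi_discrete_lipschitz_growth:
  assumes "dt \<ge> 0"
  shows "\<bar>semi_discrete dt k x - semi_discrete dt k y\<bar> \<le> (G + real k * dt * K) * norm (x - y)"
proof (induction k arbitrary: x y)
  case (Suc k)
  have "0 \<le> G + real k * dt * K" using assms G_nonneg K_nonneg by simp
  from ball_hopf_lax_lipschitz[OF Suc this assms assms, of x y]
  have "\<bar>ball_hopf_lax dt (semi_discrete dt k) x - ball_hopf_lax dt (semi_discrete dt k) y\<bar> \<le> (G + real k * dt * K) * norm (x - y)" by simp
  moreover have "\<bar>dt * V x - dt * V y\<bar> \<le> dt * (K * norm (x - y))"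
    using V_lipschitz[of x y] assms
    by (simp add: right_diff_distrib[symmetric] abs_mult mult_left_mono)
  ultimately show ?case by (simp add: algebra_simps)
qed (simp add: g_lipschitz)

lemma semi_discrete_lipschitz:
  assumes "dt \<ge> 0" "real k * dt \<le> T"
  shows "\<bar>semi_discrete dt k x - semi_discrete dt k y\<bar> \<le> (G + T * K) * norm (x - y)"
proof -
  have "(G + real k * dt * K) * norm (x - y) \<le> (G + T * K) * norm (x - y)"
    using assms K_nonneg by (intro mult_right_mono add_left_mono) auto
  with semi_discrete_lipschitz_growth[OF assms(1), of k x y] show ?thesis by linarith
qed

text \<open>
  Along a line of velocity at most \<open>R\<close> the potential differs from its value at the end point by at
  most \<open>K * dt * R\<close>, and this acts for the time \<open>dt\<close>.
\<close>

lemma viscosity_solution_le_semi_discrete: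
  fixes H :: "real ^ 'n \<Rightarrow> real"
  assumes sol: "viscosity_solution T (\<lambda>x p. H p - V x) g v"
    and conj: "\<And>\<alpha> p. \<alpha> \<bullet> p - H p \<le> L \<alpha>"
    and dt: "dt > 0" and k: "real k * dt \<le> T"
  shows "v (x, real k * dt) \<le> semi_discrete dt k x + real k * (K * R * dt\<^sup>2)"
  using k
proof (induction k arbitrary: x)
  case 0
  then show ?case using sol by (simp add: viscosity_solution_def)
next
  case (Suc k)
  define a where "a = real k * dt"
  define b where "b = real (Suc k) * dt"
  have ab: "0 \<le> a" "a < b" "b \<le> T" "b - a = dt"
    using dt Suc.prems by (auto simp: a_def b_def algebra_simps)
  have cont: "continuous_on (UNIV \<times> {a..b}) v"
    by (rule continuous_on_subset[of "UNIV \<times> {0..T}"])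
       (use sol ab in \<open>auto simp: viscosity_solution_def\<close>)
  have per: "torus_fun (\<lambda>x. v (x, s))" if "s \<in> {a..b}" for s
    using sol ab that by (auto simp: viscosity_solution_def)
  have "v (x, b) - dt * V x - real (Suc k) * (K * R * dt\<^sup>2) \<le> ball_hopf_lax dt (semi_discrete dt k) x"
  proof (rule ball_hopf_lax_greatest)
    fix \<alpha> :: "real ^ 'n" assume \<alpha>: "norm \<alpha> \<le> R"
    have "v (x, b) \<le> v (x - (b - a) *\<^sub>R \<alpha>, a) + (L \<alpha> + (V x + K * (dt * R))) * (b - a)"
    proof (rule subsolution_along_line[OF ab(1-3) cont per])
      show "viscosity_subsolution T (\<lambda>x p. H p - V x) v" using sol by (simp add: viscosity_solution_def)
      fix s assume s: "s \<in> {a..b}"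
      have "norm ((b - s) *\<^sub>R \<alpha>) \<le> dt * R"
        using s ab \<alpha> dt by (auto intro!: mult_mono)
      from mult_left_mono[OF this K_nonneg] V_lipschitz[of "x - (b - s) *\<^sub>R \<alpha>" x]
      show "L \<alpha> + V (x - (b - s) *\<^sub>R \<alpha>) \<le> L \<alpha> + (V x + K * (dt * R))" by simp
    qed (use V_lipschitz K_nonneg conj in auto)
    moreover have "v (x - dt *\<^sub>R \<alpha>, a) \<le> semi_discrete dt k (x - dt *\<^sub>R \<alpha>) + real k * (K * R * dt\<^sup>2)"
      unfolding a_def using Suc.prems dt by (intro Suc.IH) (simp add: algebra_simps)
    ultimately show "v (x, b) - dt * V x - real (Suc k) * (K * R * dt\<^sup>2)
        \<le> semi_discrete dt k (x - dt *\<^sub>R \<alpha>) + dt * L \<alpha>"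
      unfolding ab(4) by (simp add: algebra_simps power2_eq_square)
  qed
  then show ?case by (simp add: b_def)
qed

text \<open>
  Within a step the comparison function \<open>Z\<close> is the Hopf-Lax evolution plus \<open>\<tau> * V - C * \<tau>\<^sup>2\<close>, with
  \<open>\<tau>\<close> the time elapsed in the step. Along a line, the term \<open>\<tau> * V\<close> grows by more than the
  admissible \<open>\<eta> * V x\<close> because \<open>V\<close> also varies from point to point; that surplus is at most
  \<open>(\<tau> - \<eta>) * \<eta> * K * R\<close>, and the decrease of \<open>- C * \<tau>\<^sup>2\<close> compensates for it when \<open>C = K * R\<close>.
\<close>

lemma semi_discrete_le_viscosity_solution:
  fixes H :: "real ^ 'n \<Rightarrow> real"
  assumes sol: "viscosity_solution T (\<lambda>x p. H p - V x) g v"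
    and grad: "\<And>p. L (DH p) = DH p \<bullet> p - H p"
    and DH: "\<And>p. norm p \<le> 2 * (G + T * K) \<Longrightarrow> norm (DH p) \<le> R"
    and "T > 0" and dt: "dt > 0" and k: "real k * dt \<le> T"
  shows "semi_discrete dt k x - real k * (K * R * dt\<^sup>2) \<le> v (x, real k * dt)"
  using k
proof (induction k arbitrary: x)
  case 0
  then show ?case using sol by (simp add: viscosity_solution_def)
next
  case (Suc k)
  define a where "a = real k * dt"
  define b where "b = real (Suc k) * dt"
  define C where "C = K * R"
  define \<Lambda> where "\<Lambda> = G + real k * dt * K"
  have ab: "0 \<le> a" "a < b" "b \<le> T" "b - a = dt"
    using dt Suc.prems by (auto simp: a_def b_def algebra_simps)
  have cont: "continuous_on (UNIV \<times> {a..b}) v"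
    by (rule continuous_on_subset[of "UNIV \<times> {0..T}"])
       (use sol ab in \<open>auto simp: viscosity_solution_def\<close>)
  have per: "torus_fun (\<lambda>x. v (x, s))" if "s \<in> {a..b}" for s
    using sol ab that by (auto simp: viscosity_solution_def)
  have \<Lambda>: "\<Lambda> \<ge> 0" using dt G_nonneg K_nonneg by (simp add: \<Lambda>_def)
  have lip: "\<bar>semi_discrete dt k x - semi_discrete dt k y\<bar> \<le> \<Lambda> * norm (x - y)" for x y
    unfolding \<Lambda>_def using dt by (intro semi_discrete_lipschitz_growth) simp
  have B: "B \<ge> 0" using L_bounded[of 0] R_nonneg by simp
  have "continuous_on UNIV V"
    by (rule lipschitz_on_continuous_on[of K], rule lipschitz_onI)
       (use V_lipschitz K_nonneg in \<open>auto simp: dist_norm\<close>)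
  then have Vcont: "continuous_on (UNIV \<times> {0..0::real}) (\<lambda>z. V (fst z))"
    by (rule continuous_on_compose2[of UNIV V]) (auto intro: continuous_intros)
  have Vper: "torus_fun (\<lambda>x. V (fst (x, s)))" for s :: real
    using V_periodic by simp
  obtain M where M: "M \<ge> 0" "\<And>x s :: real. s \<in> {0..0} \<Longrightarrow> \<bar>V (fst (x, s))\<bar> \<le> M"
    using periodic_strip_bounded[OF Vcont Vper] by blast
  then have V_bounded: "\<bar>V x\<bar> \<le> M" for x using M(2)[of 0 x] by simp
  define Z where "Z z = ball_hopf_lax (snd z - a) (semi_discrete dt k) (fst z) + (snd z - a) * V (fst z)
      - C * (snd z - a)\<^sup>2 - real k * (C * dt\<^sup>2)" for z
  have C: "C \<ge> 0" using K_nonneg R_nonneg by (simp add: C_def)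
  have "Z (x, b) \<le> v (x, b)"
  proof (rule supersolution_ge_line_subsolution[where H = H and V = V and K = K and DH = DH
          and \<Lambda> = "G + T * K" and \<beta> = "\<Lambda> * R + B + M + 2 * C * dt", OF ab(1-3) cont per])
    show "viscosity_supersolution T (\<lambda>x p. H p - V x) v" using sol by (simp add: viscosity_solution_def)
    show "torus_fun (\<lambda>x. Z (x, s))" for s
      using ball_hopf_lax_periodic[OF semi_discrete_periodic, of "s - a" dt k] V_periodic by (simp add: torus_fun_def Z_def)
    show "Z (x, a) \<le> v (x, a)" for x
    proof -
      have "real k * dt \<le> T" using ab by (simp add: a_def)
      from Suc.IH[OF this, of x] show ?thesis by (simp add: Z_def ball_hopf_lax_0 C_def a_def)
    qed
    show "b \<in> {a..b}" using ab by simp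
    show "0 \<le> G + T * K" using G_nonneg K_nonneg \<open>T > 0\<close> by simp
    show "0 \<le> \<Lambda> * R + B + M + 2 * C * dt"
      using \<Lambda> R_nonneg B M(1) C dt by simp
    show "\<bar>Z (x, s) - Z (y, r)\<bar> \<le> (G + T * K) * norm (x - y) + (\<Lambda> * R + B + M + 2 * C * dt) * \<bar>s - r\<bar>"
      if s: "s \<in> {a..b}" and r: "r \<in> {a..b}" for x y s r
    proof -
      have sa: "0 \<le> s - a" "s - a \<le> dt" "0 \<le> r - a" "r - a \<le> dt" using s r ab(4) by auto
      have 1: "\<bar>ball_hopf_lax (s - a) (semi_discrete dt k) x - ball_hopf_lax (r - a) (semi_discrete dt k) y\<bar> \<le> \<Lambda> * norm (x - y) + (\<Lambda> * R + B) * \<bar>s - r\<bar>"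
        using ball_hopf_lax_lipschitz[OF lip \<Lambda> sa(1,3), of x y] by simp
      have 2: "\<bar>(s - a) * V x - (r - a) * V y\<bar> \<le> dt * (K * norm (x - y)) + \<bar>s - r\<bar> * M"
      proof -
        have "(s - a) * V x - (r - a) * V y = (s - a) * (V x - V y) + (s - r) * V y"
          by (simp add: algebra_simps)
        moreover have "\<bar>(s - a) * (V x - V y)\<bar> \<le> dt * (K * norm (x - y))"
          unfolding abs_mult using sa V_lipschitz[of x y] by (intro mult_mono) auto
        moreover have "\<bar>(s - r) * V y\<bar> \<le> \<bar>s - r\<bar> * M"
          unfolding abs_mult using V_bounded[of y] by (intro mult_left_mono) auto
        ultimately show ?thesis by linarith
      qed
      have 3: "\<bar>C * (s - a)\<^sup>2 - C * (r - a)\<^sup>2\<bar> \<le> 2 * C * dt * \<bar>s - r\<bar>"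
      proof -
        have "C * (s - a)\<^sup>2 - C * (r - a)\<^sup>2 = C * ((s - a) + (r - a)) * (s - r)"
          by (simp add: power2_eq_square algebra_simps)
        then have "\<bar>C * (s - a)\<^sup>2 - C * (r - a)\<^sup>2\<bar> = C * ((s - a) + (r - a)) * \<bar>s - r\<bar>"
          using C sa by (simp add: abs_mult)
        also have "\<dots> \<le> C * (2 * dt) * \<bar>s - r\<bar>"
          using C sa by (intro mult_right_mono mult_left_mono) auto
        finally show ?thesis by simp
      qed
      have "(\<Lambda> + dt * K) * norm (x - y) \<le> (G + T * K) * norm (x - y)"
      proof (rule mult_right_mono)
        have "b * K \<le> T * K" using ab(3) K_nonneg by (rule mult_right_mono)
        then show "\<Lambda> + dt * K \<le> G + T * K" by (simp add: \<Lambda>_def b_def algebra_simps)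
      qed simp
      moreover have "Z (x, s) - Z (y, r) = (ball_hopf_lax (s - a) (semi_discrete dt k) x - ball_hopf_lax (r - a) (semi_discrete dt k) y)
          + ((s - a) * V x - (r - a) * V y) - (C * (s - a)\<^sup>2 - C * (r - a)\<^sup>2)"
        by (simp add: Z_def)
      moreover have "\<Lambda> * norm (x - y) + (\<Lambda> * R + B) * \<bar>s - r\<bar>
            + (dt * (K * norm (x - y)) + \<bar>s - r\<bar> * M) + 2 * C * dt * \<bar>s - r\<bar>
          = (\<Lambda> + dt * K) * norm (x - y) + (\<Lambda> * R + B + M + 2 * C * dt) * \<bar>s - r\<bar>"
        by (simp add: distrib_left distrib_right mult_ac)
      ultimately show ?thesis using 1 2 3 by linarith
    qed
    show "Z (x, r) \<le> Z (x - \<eta> *\<^sub>R DH p, r - \<eta>) + \<eta> * (DH p \<bullet> p - H p + V x)"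
      if r: "a < r" "r \<le> b" and p: "norm p \<le> 2 * (G + T * K)" and \<eta>: "0 < \<eta>" "\<eta> \<le> r - a" for x r p \<eta>
    proof -
      define \<tau> where "\<tau> = r - a"
      define \<alpha> where "\<alpha> = DH p"
      have \<alpha>: "norm \<alpha> \<le> R" using DH[OF p] by (simp add: \<alpha>_def)
      have \<tau>: "\<eta> \<le> \<tau>" using \<eta> by (simp add: \<tau>_def)
      have 1: "ball_hopf_lax \<tau> (semi_discrete dt k) x \<le> ball_hopf_lax (\<tau> - \<eta>) (semi_discrete dt k) (x - \<eta> *\<^sub>R \<alpha>) + \<eta> * L \<alpha>"
        by (rule ball_hopf_lax_line[OF lip \<Lambda> \<alpha> \<eta>(1) \<tau>])
      have "V x - V (x - \<eta> *\<^sub>R \<alpha>) \<le> \<eta> * C"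
      proof -
        have "V x - V (x - \<eta> *\<^sub>R \<alpha>) \<le> K * (\<eta> * norm \<alpha>)"
          using V_lipschitz[of x "x - \<eta> *\<^sub>R \<alpha>"] \<eta>(1) by simp
        also have "\<dots> \<le> K * (\<eta> * R)" using \<alpha> \<eta>(1) K_nonneg by (intro mult_left_mono) auto
        finally show ?thesis by (simp add: C_def mult_ac)
      qed
      then have "(\<tau> - \<eta>) * (V x - V (x - \<eta> *\<^sub>R \<alpha>)) \<le> (\<tau> - \<eta>) * (\<eta> * C)"
        using \<tau> by (intro mult_left_mono) auto
      moreover have "(\<tau> - \<eta>) * (\<eta> * C) \<le> C * (\<tau>\<^sup>2 - (\<tau> - \<eta>)\<^sup>2)"
      proof -
        have "C * (\<tau>\<^sup>2 - (\<tau> - \<eta>)\<^sup>2) - (\<tau> - \<eta>) * (\<eta> * C) = C * \<eta> * \<tau>"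
          by (simp add: power2_eq_square algebra_simps)
        also have "\<dots> \<ge> 0" using C \<eta> \<tau> by simp
        finally show ?thesis by simp
      qed
      ultimately have 2: "\<tau> * V x - C * \<tau>\<^sup>2 \<le> (\<tau> - \<eta>) * V (x - \<eta> *\<^sub>R \<alpha>) - C * (\<tau> - \<eta>)\<^sup>2 + \<eta> * V x"
        by (simp add: algebra_simps)
      have "Z (x, r) = ball_hopf_lax \<tau> (semi_discrete dt k) x + (\<tau> * V x - C * \<tau>\<^sup>2) - real k * (C * dt\<^sup>2)"
        by (simp add: Z_def \<tau>_def)
      also have "\<dots> \<le> ball_hopf_lax (\<tau> - \<eta>) (semi_discrete dt k) (x - \<eta> *\<^sub>R \<alpha>) + \<eta> * L \<alpha>
          + ((\<tau> - \<eta>) * V (x - \<eta> *\<^sub>R \<alpha>) - C * (\<tau> - \<eta>)\<^sup>2 + \<eta> * V x) - real k * (C * dt\<^sup>2)"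
        using 1 2 by linarith
      also have "\<dots> = Z (x - \<eta> *\<^sub>R \<alpha>, r - \<eta>) + \<eta> * (L \<alpha> + V x)"
        by (simp add: Z_def \<tau>_def algebra_simps)
      finally show ?thesis by (simp add: \<alpha>_def grad)
    qed
    show "\<bar>V x - V y\<bar> \<le> K * norm (x - y)" for x y by (rule V_lipschitz)
    show "0 \<le> K" by (rule K_nonneg)
  qed
  moreover have "Z (x, b) = semi_discrete dt (Suc k) x - real (Suc k) * (K * R * dt\<^sup>2)"
    using ab(4) by (simp add: Z_def C_def algebra_simps)
  ultimately show ?case by (simp add: b_def)
qed

text \<open>
  Each step adds one interpolation error; taking the infimum over the controls is nonexpansive, so
  earlier errors are passed on without amplification.
\<close>

lemma scheme_close_to_semi_discrete:
  fixes U :: "nat \<Rightarrow> int ^ 'n \<Rightarrow> real"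
  assumes scheme: "semi_lagrangian L V g m dt N U" and m: "m \<ge> 1" and dt: "dt > 0"
    and N: "real N * dt \<le> T" and "T > 0"
    and k: "k \<le> N" and i: "i \<in> grid_indices m"
  shows "\<bar>U (N - k) i - semi_discrete dt k (grid_point m i)\<bar>
    \<le> real k * ((G + T * K) * real CARD('n) * (1 / real m))"
  using k i
proof (induction k arbitrary: i)
  case 0
  then show ?case using scheme by (simp add: semi_lagrangian_def)
next
  case (Suc k)
  let ?E = "(G + T * K) * real CARD('n) * (1 / real m)"
  let ?I = "multilinear_interp m (U (N - k))"
  have kT: "real k * dt \<le> T"
  proof -
    have "real k * dt \<le> real N * dt" using Suc.prems(1) dt by (intro mult_right_mono) auto
    then show ?thesis using N by linarith
  qed
  have \<Lambda>: "G + T * K \<ge> 0" using G_nonneg K_nonneg \<open>T > 0\<close> by simp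
  note lip = semi_discrete_lipschitz[OF less_imp_le[OF dt] kT]
  have interp: "\<bar>?I y - semi_discrete dt k y\<bar> \<le> real (Suc k) * ?E" for y
  proof -
    have "\<bar>?I y - multilinear_interp m (\<lambda>i. semi_discrete dt k (grid_point m i)) y\<bar> \<le> real k * ?E"
      by (rule multilinear_interp_nonexpansive[OF m]) (use Suc in auto)
    moreover have "\<bar>multilinear_interp m (\<lambda>i. semi_discrete dt k (grid_point m i)) y - semi_discrete dt k y\<bar> \<le> ?E"
      by (rule multilinear_interp_error[OF m semi_discrete_periodic lip \<Lambda>])
    moreover have "real (Suc k) * ?E = real k * ?E + ?E"
      unfolding of_nat_Suc distrib_right[of 1 "real k" ?E] by simp
    ultimately show ?thesis by linarith
  qed
  let ?x = "grid_point m i"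
  let ?f = "\<lambda>\<alpha>. ?I (?x - dt *\<^sub>R \<alpha>) + dt * (L \<alpha> + V ?x)"
  let ?g = "\<lambda>\<alpha>. semi_discrete dt k (?x - dt *\<^sub>R \<alpha>) + dt * L \<alpha>"
  have bdd: "bdd_below (range ?g)" and inf: "(INF \<alpha>. ?g \<alpha>) = ball_hopf_lax dt (semi_discrete dt k) ?x"
    using large_controls_useless[OF lip coercive less_imp_le[OF dt] \<Lambda>] by simp_all
  obtain c where c: "c \<le> ?g \<alpha>" for \<alpha> using bdd unfolding bdd_below_def by blast
  have bdd': "bdd_below (range (\<lambda>\<alpha>. ?g \<alpha> + dt * V ?x))"
    using c by (intro bdd_belowI2[of _ "c + dt * V ?x"]) simp
  have "bdd_below (range ?f)"
  proof -
    have "c + dt * V ?x - real (Suc k) * ?E \<le> ?f \<alpha>" for \<alpha>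
      using interp[of "?x - dt *\<^sub>R \<alpha>"] c[of \<alpha>] unfolding distrib_left by linarith
    then show ?thesis by (intro bdd_belowI2)
  qed
  moreover have "\<bar>?f \<alpha> - (?g \<alpha> + dt * V ?x)\<bar> \<le> real (Suc k) * ?E" for \<alpha>
    using interp[of "?x - dt *\<^sub>R \<alpha>"] unfolding distrib_left by linarith
  ultimately have "\<bar>(INF \<alpha>. ?f \<alpha>) - (INF \<alpha>. ?g \<alpha> + dt * V ?x)\<bar> \<le> real (Suc k) * ?E"
    using bdd' by (intro cINF_close) auto
  moreover have "(INF \<alpha>. ?g \<alpha> + dt * V ?x) = semi_discrete dt (Suc k) ?x"
  proof -
    have "(INF \<alpha>. ?g \<alpha> + dt * V ?x) = (INF \<alpha>. ?g \<alpha>) + dt * V ?x"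
    proof (rule antisym)
      have "(INF \<alpha>. ?g \<alpha> + dt * V ?x) - dt * V ?x \<le> (INF \<alpha>. ?g \<alpha>)"
      proof (rule cINF_greatest)
        show "(INF \<alpha>. ?g \<alpha> + dt * V ?x) - dt * V ?x \<le> ?g \<alpha>" for \<alpha>
          using cINF_lower[OF bdd', of \<alpha>] by simp
      qed simp
      then show "(INF \<alpha>. ?g \<alpha> + dt * V ?x) \<le> (INF \<alpha>. ?g \<alpha>) + dt * V ?x" by simp
      show "(INF \<alpha>. ?g \<alpha>) + dt * V ?x \<le> (INF \<alpha>. ?g \<alpha> + dt * V ?x)"
        by (rule cINF_greatest) (use cINF_lower[OF bdd] in auto)
    qed
    then show ?thesis by (simp add: inf)
  qed
  moreover have "U (N - Suc k) i = (INF \<alpha>. ?f \<alpha>)"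
  proof -
    have "N - Suc k < N" "Suc (N - Suc k) = N - k" using Suc.prems(1) by auto
    moreover have "\<forall>n<N. \<forall>i\<in>grid_indices m. U n i = (INF \<alpha>. multilinear_interp m (U (Suc n))
        (grid_point m i - dt *\<^sub>R \<alpha>) + dt * (L \<alpha> + V (grid_point m i)))"
      using scheme unfolding semi_lagrangian_def by (rule conjunct1)
    ultimately show ?thesis using Suc.prems(2) by simp
  qed
  ultimately show ?case by simp
qed

lemma interpolant_error:
  fixes H :: "real ^ 'n \<Rightarrow> real" and U :: "nat \<Rightarrow> int ^ 'n \<Rightarrow> real"
  assumes sol: "viscosity_solution T (\<lambda>x p. H p - V x) g v"
    and conj: "\<And>\<alpha> p. \<alpha> \<bullet> p - H p \<le> L \<alpha>"
    and grad: "\<And>p. L (DH p) = DH p \<bullet> p - H p"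
    and DH: "\<And>p. norm p \<le> 2 * (G + T * K) \<Longrightarrow> norm (DH p) \<le> R"
    and "T > 0" and scheme: "semi_lagrangian L V g m dt N U"
    and m: "m \<ge> 1" and dt: "dt > 0" and N: "N \<ge> 1" "real N * dt = T" and n: "n \<le> N"
  shows "\<bar>multilinear_interp m (U n) x - v (x, T - real n * dt)\<bar>
    \<le> (T * (K * R) + 2 * T * ((G + T * K) * real CARD('n))) * (dt + (1 / real m) / dt)"
proof -
  define k where "k = N - n"
  have k: "k \<le> N" "n = N - k" "T - real n * dt = real k * dt"
    using n N(2) by (auto simp: k_def of_nat_diff algebra_simps)
  have "real k * dt \<le> real N * dt" using k(1) dt by (intro mult_right_mono) auto
  then have kT: "real k * dt \<le> T" using N(2) by simp
  define E where "E = (G + T * K) * real CARD('n) * (1 / real m)"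
  have \<Lambda>: "G + T * K \<ge> 0" using G_nonneg K_nonneg \<open>T > 0\<close> by simp
  have E: "E \<ge> 0" using \<Lambda> by (simp add: E_def)
  have "\<bar>multilinear_interp m (U n) x - multilinear_interp m (\<lambda>i. semi_discrete dt k (grid_point m i)) x\<bar> \<le> real k * E"
    unfolding k(2) E_def
    by (intro multilinear_interp_nonexpansive[OF m] scheme_close_to_semi_discrete[OF scheme m dt _ \<open>T > 0\<close> k(1)])
       (simp_all add: N(2))
  moreover have "\<bar>multilinear_interp m (\<lambda>i. semi_discrete dt k (grid_point m i)) x - semi_discrete dt k x\<bar> \<le> E"
    unfolding E_def
    by (rule multilinear_interp_error[OF m semi_discrete_periodic semi_discrete_lipschitz[OF less_imp_le[OF dt] kT] \<Lambda>])
  moreover have "\<bar>semi_discrete dt k x - v (x, real k * dt)\<bar> \<le> real k * (K * R * dt\<^sup>2)"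
    using viscosity_solution_le_semi_discrete[OF sol conj dt kT, of x]
      semi_discrete_le_viscosity_solution[OF sol grad DH \<open>T > 0\<close> dt kT, of x] by linarith
  ultimately have "\<bar>multilinear_interp m (U n) x - v (x, T - real n * dt)\<bar>
      \<le> (real k * E + E) + real k * (K * R * dt\<^sup>2)"
    unfolding k(3) by linarith
  also have "real k * (K * R * dt\<^sup>2) \<le> T * (K * R) * dt"
  proof -
    have "(real k * dt) * (K * R * dt) \<le> T * (K * R * dt)"
      using kT K_nonneg R_nonneg dt by (intro mult_right_mono) auto
    then show ?thesis by (simp add: power2_eq_square mult_ac)
  qed
  also have "real k * E + E \<le> 2 * T * ((G + T * K) * real CARD('n)) * ((1 / real m) / dt)"
  proof -
    have "real k * E + E \<le> (2 * real N) * E"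
      using mult_right_mono[of "real k + 1" "2 * real N" E] k(1) N(1) E by (simp add: distrib_right)
    also have "real N = T / dt" using N(2) dt by (simp add: field_simps)
    finally show ?thesis by (simp add: E_def mult.commute[of dt])
  qed
  also have "2 * T * ((G + T * K) * real CARD('n)) * ((1 / real m) / dt) + T * (K * R) * dt
      \<le> (T * (K * R) + 2 * T * ((G + T * K) * real CARD('n))) * (dt + (1 / real m) / dt)"
  proof -
    have "0 \<le> T * (K * R) * ((1 / real m) / dt)" "0 \<le> 2 * T * ((G + T * K) * real CARD('n)) * dt"
      using \<open>T > 0\<close> K_nonneg R_nonneg dt \<Lambda> by simp_all
    then show ?thesis unfolding distrib_left distrib_right by linarith
  qed
  finally show ?thesis by simp
qed

end

section \<open>From uniform bounds to \<open>L\<^sup>p\<close> bounds\<close>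

text \<open>
  The fundamental domain has measure one.
\<close>

lemma torus_norm_le_const:
  fixes f :: "real ^ 'n \<Rightarrow> real"
  assumes meas: "f \<in> borel_measurable borel" and "p \<ge> 1" and "c \<ge> 0" and bd: "\<And>x. \<bar>f x\<bar> \<le> c"
  shows "torus_norm p f \<le> ennreal c"
proof -
  let ?M = "restrict_space lborel (cbox 0 1) :: (real ^ 'n) measure"
  have one: "emeasure ?M (space ?M) = 1"
  proof -
    have "(\<Prod>b\<in>Basis. (1 :: real ^ 'n) \<bullet> b) = (\<Prod>b\<in>(Basis :: (real ^ 'n) set). 1)"
      by (intro prod.cong) (auto simp: Basis_vec_def inner_axis)
    moreover have "\<forall>b\<in>(Basis :: (real ^ 'n) set). 0 \<le> (1 :: real ^ 'n) \<bullet> b"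
      by (auto simp: Basis_vec_def inner_axis)
    ultimately show ?thesis
      by (simp add: space_restrict_space emeasure_restrict_space emeasure_lborel_cbox_eq)
  qed
  have measM: "f \<in> borel_measurable ?M"
    using meas by (intro measurable_restrict_space1) simp
  show ?thesis
  proof (cases "p = \<infinity>")
    case True
    have "esssup ?M (\<lambda>x. ennreal \<bar>f x\<bar>) \<le> ennreal c"
      by (rule esssup_I) (use measM bd in \<open>auto intro!: ennreal_leI\<close>)
    then show ?thesis using True by (simp add: torus_norm_def)
  next
    case False
    define q where "q = enn2real p"
    have q: "q \<ge> 1"
      using assms(2) False unfolding q_def by (cases p) (auto simp: ennreal_1[symmetric] simp del: ennreal_1)
    define J where "J = (\<integral>\<^sup>+ x. ennreal (\<bar>f x\<bar> powr q) \<partial>?M)"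
    have "J \<le> (\<integral>\<^sup>+ x. ennreal (c powr q) \<partial>?M)"
      unfolding J_def using q bd by (intro nn_integral_mono ennreal_leI powr_mono2) auto
    also have "\<dots> = ennreal (c powr q)" using one by simp
    finally have J: "J \<le> ennreal (c powr q)" .
    then have "J \<noteq> \<infinity>" by (auto simp: top_unique)
    have "enn2real J \<le> c powr q" using J by (simp add: enn2real_leI)
    then have "enn2real J powr (1 / q) \<le> (c powr q) powr (1 / q)"
      using q by (intro powr_mono2) auto
    also have "\<dots> = c" using q \<open>c \<ge> 0\<close> by (simp add: powr_powr)
    finally show ?thesis
      using False \<open>J \<noteq> \<infinity>\<close>
      by (simp add: torus_norm_def Let_def J_def q_def ennreal_leI)
  qed
qed

lemma le_interpolated_rate:
  fixes a b M q :: real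
  assumes "a > 0" "b > 0" "M \<ge> 1" "a \<le> M * b" "0 \<le> q" "q \<le> 1"
  shows "a \<le> M * a powr q * b powr (1 - q)"
proof -
  have "a = a powr q * a powr (1 - q)" using assms(1) by (simp add: powr_add[symmetric])
  also have "a powr (1 - q) \<le> (M * b) powr (1 - q)" using assms by (intro powr_mono2) auto
  also have "\<dots> = M powr (1 - q) * b powr (1 - q)" using assms by (simp add: powr_mult)
  also have "M powr (1 - q) \<le> M powr 1" using assms by (intro powr_mono) auto
  finally show ?thesis using assms by (simp add: mult_ac)
qed

lemma enn2real_inverse_exponent:
  fixes p :: ennreal
  assumes "p \<ge> 1"
  shows "0 \<le> enn2real (1 / p)" "enn2real (1 / p) \<le> 1"
proof -
  show "enn2real (1 / p) \<le> 1"
  proof (cases p)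
    case (real r)
    then have "r \<ge> 1" using assms by (simp add: ennreal_1[symmetric] del: ennreal_1)
    then have "1 / p = ennreal (1 / r)"
      using real divide_ennreal[of 1 r] by simp
    then show ?thesis using \<open>r \<ge> 1\<close> by simp
  qed simp
qed simp

theorem corollary3p8:
  fixes H\<^sub>0 V g :: "real ^ 'n \<Rightarrow> real"
    and u :: "(real ^ 'n) \<times> real \<Rightarrow> real"
    and T :: real
  assumes "T > 0"
    and "C2 H\<^sub>0"
    and "convex_on UNIV H\<^sub>0"
    and "filterlim H\<^sub>0 at_top at_infinity"
    and "filterlim (\<lambda>p. H\<^sub>0 p / norm p) at_top at_infinity"
    and "torus_fun V" and "\<exists>K. K-lipschitz_on UNIV V" and "semiconcave V"
    and "torus_fun g" and "\<exists>K. K-lipschitz_on UNIV g" and "semiconcave g"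
    and "backward_viscosity_solution T (\<lambda>x p. H\<^sub>0 p - V x) g u"
  shows "(\<exists>C>0. \<forall>(m::nat) (N::nat) (dt::real) (h::real) U.
           m \<ge> 1 \<and> h = 1 / real m \<and> dt > 0 \<and> N \<ge> 1 \<and> real N = T / dt \<and>
           semi_lagrangian (legendre H\<^sub>0) V g m dt N U \<longrightarrow>
           (SUP n\<in>{0..N}. torus_norm 1 (\<lambda>x. multilinear_interp m (U n) x - u (x, real n * dt)))
             \<le> ennreal (C * (dt + h / dt)))
         \<and>
         (\<forall>p::ennreal. p \<ge> 1 \<longrightarrow> (\<exists>C>0. \<forall>(m::nat) (N::nat) (dt::real) (h::real) U.
           m \<ge> 1 \<and> h = 1 / real m \<and> dt > 0 \<and> N \<ge> 1 \<and> real N = T / dt \<and>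
           semi_lagrangian (legendre H\<^sub>0) V g m dt N U \<longrightarrow>
           (SUP n\<in>{0..N}. torus_norm p (\<lambda>x. multilinear_interp m (U n) x - u (x, real n * dt)))
             \<le> ennreal (C * (dt + h / dt) powr enn2real (1 / p)
                          * (dt powr (1 / 2) + h / dt) powr (1 - enn2real (1 / p)))))"
proof -
  obtain DH D2H where DH: "\<And>p. GDERIV H\<^sub>0 p :> DH p"
    and D2H: "\<And>p. (DH has_derivative blinfun_apply (D2H p)) (at p)"
    using \<open>C2 H\<^sub>0\<close> unfolding C2_def by metis
  have DH_cont: "continuous_on UNIV DH"
    using D2H by (intro continuous_at_imp_continuous_on ballI has_derivative_continuous) blast
  have H_cont: "continuous_on UNIV H\<^sub>0"
    using DH unfolding gderiv_def
    by (intro continuous_at_imp_continuous_on ballI has_derivative_continuous) blast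
  note superlinear = assms(5)
  obtain K where K: "K-lipschitz_on UNIV V" using assms(7) by blast
  obtain G where G: "G-lipschitz_on UNIV g" using assms(10) by blast
  have K': "K \<ge> 0" "\<And>x y. \<bar>V x - V y\<bar> \<le> K * norm (x - y)"
    using lipschitz_on_nonneg[OF K] lipschitz_onD[OF K] by (auto simp: dist_norm)
  have G': "G \<ge> 0" "\<And>x y. \<bar>g x - g y\<bar> \<le> G * norm (x - y)"
    using lipschitz_on_nonneg[OF G] lipschitz_onD[OF G] by (auto simp: dist_norm)
  define \<Lambda> where "\<Lambda> = G + T * K"
  have \<Lambda>: "\<Lambda> \<ge> 0" using K' G' \<open>T > 0\<close> by (simp add: \<Lambda>_def)
  have "compact (DH ` cball 0 (2 * \<Lambda>))"
    by (intro compact_continuous_image continuous_on_subset[OF DH_cont]) auto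
  then obtain R1 where R1: "\<forall>\<alpha>\<in>DH ` cball 0 (2 * \<Lambda>). norm \<alpha> \<le> R1"
    using compact_imp_bounded bounded_iff by metis
  obtain R2 where R2: "R2 \<ge> 0"
      "\<And>\<alpha>. R2 \<le> norm \<alpha> \<Longrightarrow> legendre H\<^sub>0 0 + \<Lambda> * norm \<alpha> \<le> legendre H\<^sub>0 \<alpha>"
    using legendre_coercive[OF H_cont superlinear \<Lambda>] by blast
  define R where "R = max R1 R2"
  have R: "R \<ge> 0" "R1 \<le> R" "R2 \<le> R" using R2(1) by (auto simp: R_def)
  obtain B where B: "\<And>\<alpha>. norm \<alpha> \<le> R \<Longrightarrow> \<bar>legendre H\<^sub>0 \<alpha>\<bar> \<le> B"
    using legendre_bounded_on_balls[OF H_cont superlinear] by blast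
  interpret time_stepping "legendre H\<^sub>0" R B V g K G T
    by unfold_locales
       (use R R2(2) B K' G' assms(6,9) convex_legendre[OF H_cont superlinear] in \<open>auto simp: \<Lambda>_def\<close>)
  define v where "v = (\<lambda>(x, s). u (x, T - s))"
  have sol: "viscosity_solution T (\<lambda>x p. H\<^sub>0 p - V x) g v"
    using assms(12) by (simp add: backward_viscosity_solution_def v_def)
  have vu: "v (x, T - s) = u (x, s)" for x s by (simp add: v_def)
  define C where "C = T * (K * R) + 2 * T * (\<Lambda> * real CARD('n)) + 1"
  have C: "C > 0" using \<open>T > 0\<close> K' R \<Lambda> by (simp add: C_def add_nonneg_pos)
  have error: "torus_norm p (\<lambda>x. multilinear_interp m (U n) x - u (x, real n * dt))
      \<le> ennreal (C * (dt + (1 / real m) / dt))"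
    if "p \<ge> 1" and m: "m \<ge> 1" and dt: "dt > 0" and N: "N \<ge> 1" "real N = T / dt"
      and scheme: "semi_lagrangian (legendre H\<^sub>0) V g m dt N U" and n: "n \<le> N" for p m N dt U n
  proof (rule torus_norm_le_const)
    have NT: "real N * dt = T" using N dt by simp
    have "real n * dt \<le> real N * dt" using n dt by (intro mult_right_mono) auto
    then have nT: "T - real n * dt \<in> {0..T}" using NT dt by simp
    have "continuous_on UNIV (\<lambda>x. v (x, T - real n * dt))"
      by (rule continuous_on_compose2[of "UNIV \<times> {0..T}" v])
         (use sol nT in \<open>auto simp: viscosity_solution_def intro!: continuous_intros\<close>)
    then have "(\<lambda>x. u (x, real n * dt)) \<in> borel_measurable borel"
      unfolding vu by (rule borel_measurable_continuous_onI)
    then show "(\<lambda>x. multilinear_interp m (U n) x - u (x, real n * dt)) \<in> borel_measurable borel"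
      by (intro borel_measurable_diff borel_measurable_multilinear_interp m)
    have rate: "0 \<le> dt + (1 / real m) / dt" using dt by simp
    then show "0 \<le> C * (dt + (1 / real m) / dt)" using C by simp
    fix x
    have "\<bar>multilinear_interp m (U n) x - v (x, T - real n * dt)\<bar>
        \<le> (T * (K * R) + 2 * T * ((G + T * K) * real CARD('n))) * (dt + (1 / real m) / dt)"
    proof (rule interpolant_error[OF sol _ legendre_at_gradient[OF superlinear assms(3) DH] _
          \<open>T > 0\<close> scheme m dt N(1) NT n])
      show "\<alpha> \<bullet> p - H\<^sub>0 p \<le> legendre H\<^sub>0 \<alpha>" for \<alpha> p by (rule legendre_lower[OF H_cont superlinear])
      show "norm (DH p) \<le> R" if "norm p \<le> 2 * (G + T * K)" for p
        using R1 R(2) that by (force simp: \<Lambda>_def)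
    qed
    also have "\<dots> \<le> C * (dt + (1 / real m) / dt)"
      using rate by (intro mult_right_mono) (auto simp: C_def \<Lambda>_def)
    finally show "\<bar>multilinear_interp m (U n) x - u (x, real n * dt)\<bar> \<le> C * (dt + (1 / real m) / dt)"
      unfolding vu .
  qed fact
  have part1: "\<exists>C>0. \<forall>(m::nat) (N::nat) (dt::real) (h::real) U.
           m \<ge> 1 \<and> h = 1 / real m \<and> dt > 0 \<and> N \<ge> 1 \<and> real N = T / dt \<and>
           semi_lagrangian (legendre H\<^sub>0) V g m dt N U \<longrightarrow>
           (SUP n\<in>{0..N}. torus_norm 1 (\<lambda>x. multilinear_interp m (U n) x - u (x, real n * dt)))
             \<le> ennreal (C * (dt + h / dt))"
    using C error[of 1] by (intro exI[of _ C] conjI allI impI SUP_least) auto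
  have part2: "\<exists>C>0. \<forall>(m::nat) (N::nat) (dt::real) (h::real) U.
           m \<ge> 1 \<and> h = 1 / real m \<and> dt > 0 \<and> N \<ge> 1 \<and> real N = T / dt \<and>
           semi_lagrangian (legendre H\<^sub>0) V g m dt N U \<longrightarrow>
           (SUP n\<in>{0..N}. torus_norm p (\<lambda>x. multilinear_interp m (U n) x - u (x, real n * dt)))
             \<le> ennreal (C * (dt + h / dt) powr enn2real (1 / p)
                          * (dt powr (1 / 2) + h / dt) powr (1 - enn2real (1 / p)))"
    if p: "p \<ge> 1" for p :: ennreal
  proof -
    define M where "M = max 1 (sqrt T)"
    have M: "M \<ge> 1" "sqrt T \<le> M" by (auto simp: M_def)
    have rate: "C * (dt + h / dt) \<le> C * M * (dt + h / dt) powr enn2real (1 / p)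
          * (dt powr (1 / 2) + h / dt) powr (1 - enn2real (1 / p))"
      if "dt > 0" "h > 0" "dt \<le> T" for dt h :: real
    proof -
      have "sqrt dt \<le> M"
        using M(2) real_sqrt_le_mono[OF \<open>dt \<le> T\<close>] by linarith
      then have "sqrt dt * sqrt dt \<le> M * sqrt dt"
        using \<open>dt > 0\<close> by (intro mult_right_mono) auto
      then have "dt \<le> M * dt powr (1 / 2)"
        using \<open>dt > 0\<close> by (simp add: powr_half_sqrt)
      moreover have "h / dt \<le> M * (h / dt)" 
        using mult_right_mono[OF M(1), of "h / dt"] that by simp
      ultimately have "dt + h / dt \<le> M * (dt powr (1 / 2) + h / dt)" by (simp add: distrib_left)
      then have "dt + h / dt \<le> M * (dt + h / dt) powr enn2real (1 / p)
          * (dt powr (1 / 2) + h / dt) powr (1 - enn2real (1 / p))"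
        using that M(1) enn2real_inverse_exponent[OF p]
        by (intro le_interpolated_rate) (auto intro!: add_pos_pos)
      from mult_left_mono[OF this, of C] C show ?thesis by (simp add: mult.assoc)
    qed
    show ?thesis
    proof (intro exI[of _ "C * M"] conjI allI impI SUP_least)
      show "C * M > 0" using C M by simp
      fix m N :: nat and dt h :: real and U :: "nat \<Rightarrow> int ^ 'n \<Rightarrow> real" and n
      assume a: "m \<ge> 1 \<and> h = 1 / real m \<and> dt > 0 \<and> N \<ge> 1 \<and> real N = T / dt \<and>
           semi_lagrangian (legendre H\<^sub>0) V g m dt N U" and n: "n \<in> {0..N}"
      have "dt \<le> T"
      proof -
        have N: "N \<ge> 1" "dt > 0" "real N = T / dt" using a by blast+
        from N(1,2) have "1 * dt \<le> real N * dt" by (intro mult_right_mono) simp_all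
        also have "real N * dt = T" using N(2,3) by simp
        finally show ?thesis by simp
      qed
      have "torus_norm p (\<lambda>x. multilinear_interp m (U n) x - u (x, real n * dt)) \<le> ennreal (C * (dt + h / dt))"
        using error[OF p, of m dt N U n] a n by auto
      also have "\<dots> \<le> ennreal (C * M * (dt + h / dt) powr enn2real (1 / p)
          * (dt powr (1 / 2) + h / dt) powr (1 - enn2real (1 / p)))"
        using a \<open>dt \<le> T\<close> by (intro ennreal_leI rate) auto
      finally show "torus_norm p (\<lambda>x. multilinear_interp m (U n) x - u (x, real n * dt))
          \<le> ennreal (C * M * (dt + h / dt) powr enn2real (1 / p)
          * (dt powr (1 / 2) + h / dt) powr (1 - enn2real (1 / p)))" .
    qed
  qed
  show ?thesis using part1 part2 by blast
qed

end
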